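(* Fix a constant $\delta\in(0,2\sqrt L\,M)$. There exist constants $C_s,\tilde C_s>0$ depending on $s$ (and on the fixed quantities $L,m,M,\epsilon$) such that for all $n\ge C_s\,\delta^{-4}\sigma^{12}$ and for all $\theta\in\mathcal T$, with $s=|\mathrm{supp}(\theta)|$, the restricted maximum likelihood estimator $\tilde\theta_n$ based on $n$ i.i.d. samples from $P_\theta$ satisfies $$P\big(\rho(\tilde\theta_n,\theta)\ge\delta\big)\ \le\ C_s\,\sigma^{5s}\delta^{-2s}\exp\Big(-\frac{\tilde C_s\,n\,\delta^4}{\sigma^{12}}\Big).$$
   Context: Fix a dimension $L\ge1$ and identify $\mathbb R^L$ with functions $\mathbb Z/L\mathbb Z\to\mathbb R$. Let $\mathcal R=\{R^{(\ell)}:1\le \ell\le L\}$ be the group of cyclic shifts, $(R^{(\ell)}\theta)(i)=\theta(i+\ell)$. For $\theta,\phi\in\mathbb R^L$ let $\rho(\theta,\phi)=\min_{G\in\mathcal R}\|\theta-G\phi\|$ (Euclidean norm). For noise level $\sigma>0$, $P_\theta$ is the law of $X=G\theta+\sigma\xi$, where $G$ is uniform on $\mathcal R$ and $\xi\sim\mathcal N(0,I_L)$ is independent of $G$. A vector $\theta\in\mathbb R^L$ is collision-free if every element of the multiset $\mathcal D(\theta)=\{i-j \ (\mathrm{mod}\ L): i,j\in\mathrm{supp}(\theta),\ i\ne j\}$ has multiplicity exactly $1$. Fix positive constants $m,M,\epsilon$. $\mathcal T$ is the set of $\theta\in\mathbb R^L$ such that (i) $\theta$ is collision-free; (ii) $\sigma\ge\|\theta\|$;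 (iii) $m\le|\theta(i)|\le M$ for all $i\in\mathrm{supp}(\theta)$ and $s:=|\mathrm{supp}(\theta)|\ge\max\{7,(2+\epsilon)M^2/m^2\}$. The quantities $L,m,M,\epsilon$ are fixed throughout; constants do not depend on $\sigma$ or $n$. Given i.i.d. samples $X_1,\dots,X_n$ from $P_\theta$, the restricted MLE $\tilde\theta_n$ is a maximizer over $\phi\in\mathcal T$ of $\sum_{i=1}^n\log\mathbb E_G\big[\exp\big(-\tfrac1{2\sigma^2}\|X_i-G\phi\|^2\big)\big]$, where $\mathbb E_G$ averages over $G$ uniform on $\mathcal R$. *)

theory Defs
  imports
    "HOL-Probability.Probability"
    "Berlekamp_Zassenhaus.Finite_Field"
begin

text \<open>
  Every finite type \<open>'l\<close> yields the ring \<open>'l mod_ring\<close> of integers modulo \<open>L = CARD('l)\<close>, so that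
  \<open>real ^ 'l mod_ring\<close> is the Euclidean space of functions from \<open>\<int>/L\<int>\<close> to \<open>\<real>\<close>. All \<open>L \<ge> 1\<close> are
  covered, since types are nonempty.
\<close>

type_synonym 'l signal = "real ^ 'l mod_ring"

definition shift :: "'l::finite mod_ring \<Rightarrow> 'l signal \<Rightarrow> 'l signal" where
  "shift l \<theta> = (\<chi> i. \<theta> $ (i + l))"

definition cyclic_shifts :: "('l::finite signal \<Rightarrow> 'l signal) set" where
  "cyclic_shifts = range shift"

definition orbit_dist :: "'l::finite signal \<Rightarrow> 'l signal \<Rightarrow> real" where
  "orbit_dist \<theta> \<phi> = (MIN G\<in>cyclic_shifts. norm (\<theta> - G \<phi>))"

definition supp :: "'l::finite signal \<Rightarrow> 'l mod_ring set" where
  "supp \<theta> = {i. \<theta> $ i \<noteq> 0}"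

text \<open>Differences are taken over ordered pairs.\<close>

definition differences :: "'l::finite signal \<Rightarrow> 'l mod_ring multiset" where
  "differences \<theta> =
     image_mset (\<lambda>(i, j). i - j) (mset_set {(i, j). i \<in> supp \<theta> \<and> j \<in> supp \<theta> \<and> i \<noteq> j})"

definition collision_free :: "'l::finite signal \<Rightarrow> bool" where
  "collision_free \<theta> \<longleftrightarrow> (\<forall>d\<in>#differences \<theta>. count (differences \<theta>) d = 1)"

definition sparse_signals :: "real \<Rightarrow> real \<Rightarrow> real \<Rightarrow> real \<Rightarrow> 'l::finite signal set" where
  "sparse_signals m M \<epsilon> \<sigma> =
     {\<theta>. collision_free \<theta> \<and> norm \<theta> \<le> \<sigma> \<and>
         (\<forall>i\<in>supp \<theta>. m \<le> \<bar>\<theta> $ i\<bar> \<and> \<bar>\<theta> $ i\<bar> \<le> M) \<and>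
         real (card (supp \<theta>)) \<ge> max 7 ((2 + \<epsilon>) * M\<^sup>2 / m\<^sup>2)}"

text \<open>The standard normal law \<open>N(0, I)\<close>: independent standard normal coordinates.\<close>

definition std_gaussian :: "'l::finite signal measure" where
  "std_gaussian =
     distr (\<Pi>\<^sub>M i\<in>UNIV. density lborel (\<lambda>x. ennreal (std_normal_density x))) borel vec_lambda"

definition sample_law :: "real \<Rightarrow> 'l::finite signal \<Rightarrow> 'l signal measure" where
  "sample_law \<sigma> \<theta> =
     distr (measure_pmf (pmf_of_set cyclic_shifts) \<Otimes>\<^sub>M std_gaussian) borel
       (\<lambda>(G, \<xi>). G \<theta> + \<sigma> *\<^sub>R \<xi>)"

definition samples :: "real \<Rightarrow> nat \<Rightarrow> 'l::finite signal \<Rightarrow> (nat \<Rightarrow> 'l signal) measure" where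
  "samples \<sigma> n \<theta> = (\<Pi>\<^sub>M i\<in>{..<n}. sample_law \<sigma> \<theta>)"

definition log_likelihood ::
  "real \<Rightarrow> nat \<Rightarrow> (nat \<Rightarrow> 'l::finite signal) \<Rightarrow> 'l signal \<Rightarrow> real" where
  "log_likelihood \<sigma> n X \<phi> =
     (\<Sum>i<n. ln (measure_pmf.expectation (pmf_of_set cyclic_shifts)
        (\<lambda>G. exp (- (1 / (2 * \<sigma>\<^sup>2)) * (norm (X i - G \<phi>))\<^sup>2))))"

text \<open>
  An estimator is a measurable function of the observations; where the maximizer is not unique,
  any measurable choice is admitted.
\<close>

definition restricted_MLE ::
  "real \<Rightarrow> real \<Rightarrow> real \<Rightarrow> real \<Rightarrow> nat \<Rightarrow> ((nat \<Rightarrow> 'l::finite signal) \<Rightarrow> 'l signal) \<Rightarrow> bool" where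
  "restricted_MLE m M \<epsilon> \<sigma> n est \<longleftrightarrow>
     est \<in> borel_measurable (\<Pi>\<^sub>M i\<in>{..<n}. borel) \<and>
     (\<forall>X\<in>space (\<Pi>\<^sub>M i\<in>{..<n}. borel).
        is_arg_max (log_likelihood \<sigma> n X) (\<lambda>\<phi>. \<phi> \<in> sparse_signals m M \<epsilon> \<sigma>) (est X))"

end

theory Submission
  imports Defs
begin

text \<open>
  Moments taken over distinct coordinates are not biased by the noise, and for a collision-free
  signal each of them is a single product of entries. Those of order two and three therefore
  determine the signal up to a shift, and they do so in a Lipschitz way. Testing the laws
  \<open>P\<^sub>\<theta>\<close> and \<open>P\<^sub>\<phi>\<close> against these cubic polynomials, whose variance is of
  order \<open>\<sigma>\<^sup>6\<close>, shows that their squared Hellinger distance is at least of order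
  \<open>\<rho>(\<theta>, \<phi>)\<^sup>2 / \<sigma>\<^sup>6\<close>. By the Chernoff bound with exponent \<open>1/2\<close>, a fixed
  \<open>\<phi>\<close> at distance \<open>\<delta>\<close> beats \<open>\<theta>\<close> with probability at most \<open>exp (- c n / t)\<close>, where
  \<open>t = \<sigma>\<^sup>6 / \<delta>\<^sup>2\<close>. The log-likelihood is Lipschitz, so a union bound over a net with
  \<open>O(t\<^sup>L)\<close> points suffices, and this factor is absorbed by the exponential because
  \<open>n \<ge> C t\<^sup>2\<close>. As \<open>t\<close> is bounded below, what remains of \<open>exp (- c n / t)\<close> is at most
  \<open>exp (- c' n / t\<^sup>2)\<close>, and \<open>\<sigma>\<^sup>5 / \<delta>\<^sup>2\<close> is bounded below too, so the
  prefactor \<open>\<sigma> ^ (5 s) / \<delta> ^ (2 s)\<close> only costs a constant.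
\<close>

section \<open>Shifts and moments\<close>

lemma finite_cyclic_shifts [simp, intro]: "finite (cyclic_shifts :: ('l::finite signal \<Rightarrow> _) set)"
  unfolding cyclic_shifts_def by simp

lemma cyclic_shifts_nonempty [simp]: "(cyclic_shifts :: ('l::finite signal \<Rightarrow> _) set) \<noteq> {}"
  unfolding cyclic_shifts_def by simp

lemma card_cyclic_shifts_pos [simp]: "card (cyclic_shifts :: ('l::finite signal \<Rightarrow> _) set) > 0"
  by (simp add: card_gt_0_iff)

lemma bij_add_mod_ring: "bij (\<lambda>i. i + l :: 'l::finite mod_ring)"
  by (rule bij_betwI[of _ _ _ "\<lambda>i. i - l"]) auto

lemma norm_shift [simp]: "norm (shift l \<theta>) = norm \<theta>"
proof -
  have "(\<Sum>i\<in>UNIV. (norm (\<theta> $ (i + l)))\<^sup>2) = (\<Sum>i\<in>UNIV. (norm (\<theta> $ i))\<^sup>2)"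
    using sum.reindex_bij_betw[OF bij_add_mod_ring, of "\<lambda>i. (norm (\<theta> $ i))\<^sup>2" l] by simp
  thus ?thesis by (simp add: norm_vec_def L2_set_def shift_def)
qed

lemma shift_diff: "shift l (\<theta> - \<phi>) = shift l \<theta> - shift l \<phi>"
  by (simp add: shift_def vec_eq_iff)

lemma shift_shift: "shift k (shift l \<theta>) = shift (k + l) \<theta>"
  by (simp add: shift_def vec_eq_iff add.assoc)

lemma shift_0 [simp]: "shift 0 \<theta> = \<theta>"
  by (simp add: shift_def vec_eq_iff)

lemma norm_cyclic_shift: "G \<in> cyclic_shifts \<Longrightarrow> norm (G \<theta>) = norm \<theta>"
  by (auto simp: cyclic_shifts_def)

lemma cyclic_shift_diff: "G \<in> cyclic_shifts \<Longrightarrow> G (\<theta> - \<phi>) = G \<theta> - G \<phi>"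
  by (auto simp: cyclic_shifts_def shift_diff)

text \<open>\<open>orbit_dist\<close> minimises over shifts of its second argument. The inverse
  shift is an isometry, so a shift of the first argument serves as well.\<close>

lemma orbit_dist_le: "orbit_dist \<phi> \<theta> \<le> norm (shift l \<phi> - \<theta>)"
proof -
  have "shift (-l) (shift l \<phi> - \<theta>) = \<phi> - shift (-l) \<theta>"
    by (simp add: shift_diff shift_shift)
  hence "norm (shift l \<phi> - \<theta>) = norm (\<phi> - shift (-l) \<theta>)"
    by (metis norm_shift)
  also have "\<dots> \<ge> orbit_dist \<phi> \<theta>"
    unfolding orbit_dist_def by (rule Min_le) (auto simp: cyclic_shifts_def)
  finally show ?thesis by simp
qed

lemma orbit_dist_nonneg: "0 \<le> orbit_dist \<phi> \<theta>"
  unfolding orbit_dist_def by (subst Min_ge_iff) auto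

text \<open>For pairs this is an autocorrelation, for triples a third-order correlation. Indexing by
  a set keeps the coordinates within each product distinct, which makes it unbiased under
  independent noise.\<close>

definition shift_monomial :: "'l::finite mod_ring set \<Rightarrow> 'l signal \<Rightarrow> real" where
  "shift_monomial J x = (\<Sum>l\<in>UNIV. \<Prod>k\<in>(\<lambda>j. j + l) ` J. x $ k)"

lemma shift_monomial_shift [simp]: "shift_monomial J (shift r x) = shift_monomial J x"
proof -
  have "(\<Prod>k\<in>(\<lambda>j. j + l) ` J. shift r x $ k) = (\<Prod>k\<in>(\<lambda>j. j + (l + r)) ` J. x $ k)" for l
    by (simp add: shift_def prod.reindex inj_on_def add.assoc)
  hence "shift_monomial J (shift r x) = (\<Sum>l\<in>UNIV. \<Prod>k\<in>(\<lambda>j. j + (l + r)) ` J. x $ k)"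
    by (simp add: shift_monomial_def)
  also have "\<dots> = shift_monomial J x"
    unfolding shift_monomial_def
    by (rule sum.reindex_bij_betw[OF bij_add_mod_ring, of "\<lambda>l. \<Prod>k\<in>(\<lambda>j. j + l) ` J. x $ k"])
  finally show ?thesis .
qed

lemma shift_monomial_cyclic_shift: "G \<in> cyclic_shifts \<Longrightarrow> shift_monomial J (G x) = shift_monomial J x"
  by (auto simp: cyclic_shifts_def)

text \<open>Multiplicity one in the multiset of differences means that the fibre of the difference
  map over \<open>i - j\<close> is a single ordered pair.\<close>

lemma collision_freeD:
  assumes "collision_free \<theta>" and "i \<in> supp \<theta>" "j \<in> supp \<theta>" "i' \<in> supp \<theta>" "j' \<in> supp \<theta>"
    and "i \<noteq> j" and eq: "i - j = i' - j'"
  shows "i = i'" "j = j'"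
proof -
  let ?P = "{(i, j). i \<in> supp \<theta> \<and> j \<in> supp \<theta> \<and> i \<noteq> j}"
  let ?Q = "{x \<in> ?P. (case x of (i, j) \<Rightarrow> i - j) = i - j}"
  have "i' \<noteq> j'" using assms by auto
  have "i - j \<in># differences \<theta>"
    using assms unfolding differences_def by (auto intro!: image_eqI[of _ _ "(i, j)"])
  hence "count (differences \<theta>) (i - j) = 1"
    using assms(1) unfolding collision_free_def by blast
  hence "card ?Q = 1"
    unfolding differences_def count_image_mset by (simp add: Collect_conj_eq Int_commute vimage_def)
  then obtain z where z: "?Q = {z}" by (auto simp: card_1_singleton_iff)
  have "(i, j) \<in> ?Q" "(i', j') \<in> ?Q" using assms \<open>i' \<noteq> j'\<close> by auto
  hence "(i, j) = (i', j')" unfolding z by simp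
  thus "i = i'" "j = j'" by auto
qed

text \<open>Moving both indices by \<open>l\<close> is a bijection between the ordered pairs of the
  two supports and keeps their difference, so the multisets of differences agree.\<close>

lemma collision_free_shift:
  assumes "collision_free \<theta>"
  shows "collision_free (shift l \<theta>)"
proof -
  let ?P = "\<lambda>\<theta>::'a signal. {(i, j). i \<in> supp \<theta> \<and> j \<in> supp \<theta> \<and> i \<noteq> j}"
  have s: "i \<in> supp (shift l \<theta>) \<longleftrightarrow> i + l \<in> supp \<theta>" for i by (simp add: supp_def shift_def)
  have "?P \<theta> = (\<lambda>(i, j). (i + l, j + l)) ` ?P (shift l \<theta>)"
  proof safe
    fix i j assume "i \<in> supp \<theta>" "j \<in> supp \<theta>" "i \<noteq> j"
    thus "(i, j) \<in> (\<lambda>(i, j). (i + l, j + l)) ` ?P (shift l \<theta>)"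
      by (intro image_eqI[of _ _ "(i - l, j - l)"]) (auto simp: s)
  qed (auto simp: s)
  moreover have "inj (\<lambda>(i, j). (i + l, j + l))" by (auto simp: inj_on_def)
  ultimately have "mset_set (?P \<theta>) = image_mset (\<lambda>(i, j). (i + l, j + l)) (mset_set (?P (shift l \<theta>)))"
    by (metis (no_types, lifting) image_mset_mset_set inj_on_subset subset_UNIV)
  hence "differences \<theta> = differences (shift l \<theta>)"
    unfolding differences_def by (simp add: image_mset.compositionality o_def case_prod_unfold)
  thus ?thesis using assms by (simp add: collision_free_def)
qed

text \<open>At most one translate of \<open>J\<close> fits into a collision-free support, so the sum has at most
  one nonzero term.\<close>

lemma shift_monomial_collision_free:
  assumes "collision_free \<theta>" "p \<in> J" "q \<in> J" "p \<noteq> q" "J \<subseteq> supp \<theta>"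
  shows "shift_monomial J \<theta> = (\<Prod>k\<in>J. \<theta> $ k)"
proof -
  have "(\<Prod>k\<in>(\<lambda>j. j + l) ` J. \<theta> $ k) = 0" if "l \<noteq> 0" for l
  proof (rule ccontr)
    assume "(\<Prod>k\<in>(\<lambda>j. j + l) ` J. \<theta> $ k) \<noteq> 0"
    hence "(\<lambda>j. j + l) ` J \<subseteq> supp \<theta>" by (auto simp: supp_def)
    hence "p + l \<in> supp \<theta>" "q + l \<in> supp \<theta>" using assms by auto
    moreover have "p \<in> supp \<theta>" "q \<in> supp \<theta>" using assms by auto
    ultimately have "p = p + l"
      using collision_freeD[OF assms(1), of p q "p + l" "q + l"] assms(4) by simp
    thus False using that by simp
  qed
  hence "shift_monomial J \<theta> = (\<Sum>l\<in>{0}. \<Prod>k\<in>(\<lambda>j. j + l) ` J. \<theta> $ k)"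
    unfolding shift_monomial_def by (intro sum.mono_neutral_right) auto
  thus ?thesis by simp
qed

lemma shift_monomial_nonzeroD:
  assumes "shift_monomial J \<theta> \<noteq> 0"
  obtains l where "(\<lambda>j. j + l) ` J \<subseteq> supp \<theta>"
proof -
  obtain l where "(\<Prod>k\<in>(\<lambda>j. j + l) ` J. \<theta> $ k) \<noteq> 0"
    using assms unfolding shift_monomial_def by (meson sum.neutral)
  hence "(\<lambda>j. j + l) ` J \<subseteq> supp \<theta>" by (auto simp: supp_def)
  thus ?thesis by (rule that)
qed

section \<open>Stable recovery of a signal from its second and third moments\<close>

lemma abs_diff_quotient_le:
  fixes a a' x x' :: real
  assumes "\<bar>a * x - a' * x'\<bar> \<le> d" "\<bar>a - a'\<bar> \<le> e" "\<bar>x'\<bar> \<le> M" "0 < b" "b \<le> \<bar>a\<bar>"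
  shows "\<bar>x - x'\<bar> \<le> (d + M * e) / b"
proof -
  have "b * \<bar>x - x'\<bar> \<le> \<bar>a\<bar> * \<bar>x - x'\<bar>" using assms by (intro mult_right_mono) auto
  \<comment> \<open>Splitting off the error in the divisor leaves the error in the product, so
    division is stable as long as \<open>a\<close> stays away from zero.\<close>
  also have "\<dots> = \<bar>(a * x - a' * x') - x' * (a - a')\<bar>"
    by (simp add: abs_mult[symmetric] algebra_simps)
  also have "\<dots> \<le> d + \<bar>x'\<bar> * \<bar>a - a'\<bar>"
    using assms(1) by (intro order_trans[OF abs_triangle_ineq4]) (simp add: abs_mult)
  also have "\<dots> \<le> d + M * e" using assms by (intro add_left_mono mult_mono) auto
  finally show ?thesis using assms(4) by (simp add: pos_le_divide_eq mult.commute)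
qed

text \<open>Three support points are asked for since a coordinate is recovered with the help of two
  others.\<close>

definition bounded_collision_free :: "real \<Rightarrow> real \<Rightarrow> 'l::finite signal \<Rightarrow> bool" where
  "bounded_collision_free m M \<theta> \<longleftrightarrow>
     collision_free \<theta> \<and> (\<forall>i\<in>supp \<theta>. m \<le> \<bar>\<theta> $ i\<bar> \<and> \<bar>\<theta> $ i\<bar> \<le> M) \<and> 3 \<le> card (supp \<theta>)"

lemma bounded_collision_free_shift:
  assumes "bounded_collision_free m M \<theta>"
  shows "bounded_collision_free m M (shift l \<theta>)"
proof -
  have "bij_betw (\<lambda>i. i + l) (supp (shift l \<theta>)) (supp \<theta>)"
    by (rule bij_betwI[of _ _ _ "\<lambda>i. i - l"]) (auto simp: supp_def shift_def)
  hence "card (supp (shift l \<theta>)) = card (supp \<theta>)" by (rule bij_betw_same_card)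
  thus ?thesis using assms
    by (auto simp: bounded_collision_free_def collision_free_shift) (auto simp: supp_def shift_def)
qed

text \<open>The monomial of \<open>{p, q, k}\<close> has size at least \<open>m ^ 3\<close> at
  \<open>\<theta>\<close>, hence it is nonzero at \<open>\<phi>\<close>, and some translate of the
  triple lies in \<open>supp \<phi>\<close>. As \<open>p\<close> and \<open>q\<close> already lie
  there, collision-freeness forces the translation to be trivial. The opposite inclusion follows by
  exchanging the signals.\<close>

lemma moments_determine_support:
  assumes \<theta>: "bounded_collision_free m M \<theta>" and \<phi>: "collision_free \<phi>" and m: "0 < m"
    and pq: "p \<noteq> q" "p \<in> supp \<theta>" "q \<in> supp \<theta>" "p \<in> supp \<phi>" "q \<in> supp \<phi>"
    and close: "\<And>J. 2 \<le> card J \<Longrightarrow> card J \<le> 3 \<Longrightarrow> \<bar>shift_monomial J \<theta> - shift_monomial J \<phi>\<bar> < m ^ 3"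
  shows "supp \<theta> \<subseteq> supp \<phi>"
proof
  fix k assume k: "k \<in> supp \<theta>"
  show "k \<in> supp \<phi>"
  proof (cases "k = p \<or> k = q")
    case False
    let ?J = "{p, q, k}"
    have cf: "collision_free \<theta>" and b: "\<And>i. i \<in> supp \<theta> \<Longrightarrow> m \<le> \<bar>\<theta> $ i\<bar>"
      using \<theta> by (auto simp: bounded_collision_free_def)
    have "shift_monomial ?J \<theta> = (\<Prod>k\<in>?J. \<theta> $ k)"
      using pq k by (intro shift_monomial_collision_free[OF cf, of p _ q]) auto
    hence "\<bar>shift_monomial ?J \<theta>\<bar> = \<bar>\<theta> $ p\<bar> * (\<bar>\<theta> $ q\<bar> * \<bar>\<theta> $ k\<bar>)"
      using False pq by (auto simp: abs_mult)
    also have "\<dots> \<ge> m * (m * m)"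
      using m by (intro mult_mono b pq k) auto
    finally have "m ^ 3 \<le> \<bar>shift_monomial ?J \<theta>\<bar>" by (simp add: power3_eq_cube)
    moreover have "\<bar>shift_monomial ?J \<theta> - shift_monomial ?J \<phi>\<bar> < m ^ 3"
      using False pq by (intro close) auto
    ultimately have "shift_monomial ?J \<phi> \<noteq> 0" by auto
    then obtain l where l: "(\<lambda>j. j + l) ` ?J \<subseteq> supp \<phi>" by (rule shift_monomial_nonzeroD)
    hence "p = p + l"
      using collision_freeD[OF \<phi>, of p q "p + l" "q + l"] pq by simp
    thus ?thesis using l by simp
  qed (use pq in auto)
qed

text \<open>The value at \<open>k\<close> is a quotient of two products, over
  \<open>{p, q, k}\<close> and over \<open>{p, q}\<close>. Each product is a whole monomial because
  both signals are collision-free with the same support, and the divisor has size at least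
  \<open>m ^ 2\<close>.\<close>

lemma moments_determine_values:
  assumes \<theta>: "bounded_collision_free m M \<theta>" and \<phi>: "bounded_collision_free m M \<phi>" and m: "0 < m"
    and S: "supp \<phi> = supp \<theta>"
    and close: "\<And>J. 2 \<le> card J \<Longrightarrow> card J \<le> 3 \<Longrightarrow> \<bar>shift_monomial J \<theta> - shift_monomial J \<phi>\<bar> \<le> \<Delta>"
    and k: "k \<in> supp \<theta>"
  shows "\<bar>\<theta> $ k - \<phi> $ k\<bar> \<le> (1 + M) / m\<^sup>2 * \<Delta>"
proof -
  have cf: "collision_free \<theta>" "collision_free \<phi>" and c: "3 \<le> card (supp \<theta>)"
    and b: "\<And>i. i \<in> supp \<theta> \<Longrightarrow> m \<le> \<bar>\<theta> $ i\<bar>" and b': "\<And>i. i \<in> supp \<theta> \<Longrightarrow> \<bar>\<phi> $ i\<bar> \<le> M"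
    using \<theta> \<phi> S by (auto simp: bounded_collision_free_def)
  \<comment> \<open>The reference pair must avoid \<open>k\<close>, so that the triple has three
    elements and its product contains the value at \<open>k\<close> exactly once.\<close>
  have "card (supp \<theta> - {k}) \<ge> 2" using c k by simp
  then obtain B where B: "B \<subseteq> supp \<theta> - {k}" "card B = 2" by (meson obtain_subset_with_card_n)
  then obtain p q where pq: "p \<noteq> q" "p \<in> supp \<theta>" "q \<in> supp \<theta>" "k \<noteq> p" "k \<noteq> q"
    by (auto simp: card_2_iff)
  have prod: "\<bar>(\<Prod>k\<in>J. \<theta> $ k) - (\<Prod>k\<in>J. \<phi> $ k)\<bar> \<le> \<Delta>"
    if J: "J \<subseteq> supp \<theta>" "p \<in> J" "q \<in> J" "card J \<le> 3" for J
  proof -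
    have "card {p, q} \<le> card J" using J by (intro card_mono) auto
    hence "2 \<le> card J" using pq by simp
    moreover have "shift_monomial J \<theta> = (\<Prod>k\<in>J. \<theta> $ k)" "shift_monomial J \<phi> = (\<Prod>k\<in>J. \<phi> $ k)"
      using J pq S cf by (auto intro!: shift_monomial_collision_free[of _ p _ q])
    ultimately show ?thesis using close[of J] J(4) by simp
  qed
  have "\<bar>\<theta> $ p * \<theta> $ q * \<theta> $ k - \<phi> $ p * \<phi> $ q * \<phi> $ k\<bar> \<le> \<Delta>"
    using prod[of "{p, q, k}"] pq k by (simp add: mult.assoc)
  moreover have "\<bar>\<theta> $ p * \<theta> $ q - \<phi> $ p * \<phi> $ q\<bar> \<le> \<Delta>"
    using prod[of "{p, q}"] pq by simp
  moreover have "m\<^sup>2 \<le> \<bar>\<theta> $ p * \<theta> $ q\<bar>"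
    unfolding abs_mult power2_eq_square using m by (intro mult_mono b pq) auto
  ultimately have "\<bar>\<theta> $ k - \<phi> $ k\<bar> \<le> (\<Delta> + M * \<Delta>) / m\<^sup>2"
    using m b'[OF k] by (intro abs_diff_quotient_le[where a = "\<theta> $ p * \<theta> $ q" and a' = "\<phi> $ p * \<phi> $ q"]) auto
  also have "\<dots> = (1 + M) / m\<^sup>2 * \<Delta>" by (simp add: algebra_simps)
  finally show ?thesis .
qed

text \<open>A pair \<open>p, q\<close> of the support is located through the second moment; the third moments
  \<open>{p, q, k}\<close> then reveal whether \<open>k\<close> is in the support and, divided by the second
  moment \<open>{p, q}\<close>, its value.\<close>

lemma orbit_dist_le_moments:
  assumes \<theta>: "bounded_collision_free m M \<theta>" and \<phi>: "bounded_collision_free m M \<phi>"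
    and m: "0 < m" and M: "0 < M"
    and close: "\<And>J. 2 \<le> card J \<Longrightarrow> card J \<le> 3 \<Longrightarrow> \<bar>shift_monomial J \<theta> - shift_monomial J \<phi>\<bar> \<le> \<Delta>"
    and small: "\<Delta> < min (m\<^sup>2) (m ^ 3)"
  shows "orbit_dist (\<phi> :: 'l::finite signal) \<theta> \<le> CARD('l) * ((1 + M) / m\<^sup>2 * \<Delta>)"
proof -
  have cf: "collision_free \<theta>" and c: "3 \<le> card (supp \<theta>)"
    and b: "\<And>i. i \<in> supp \<theta> \<Longrightarrow> m \<le> \<bar>\<theta> $ i\<bar>"
    using \<theta> by (auto simp: bounded_collision_free_def)
  have "2 \<le> card (supp \<theta>)" using c by simp
  then obtain B where B: "B \<subseteq> supp \<theta>" "card B = 2" by (meson obtain_subset_with_card_n)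
  then obtain p q where pq: "p \<noteq> q" "p \<in> supp \<theta>" "q \<in> supp \<theta>"
    by (auto simp: card_2_iff)
  have "shift_monomial {p, q} \<theta> = (\<Prod>k\<in>{p, q}. \<theta> $ k)"
    using pq by (intro shift_monomial_collision_free[OF cf, of p _ q]) auto
  hence "\<bar>shift_monomial {p, q} \<theta>\<bar> = \<bar>\<theta> $ p\<bar> * \<bar>\<theta> $ q\<bar>"
    using pq by (simp add: abs_mult)
  also have "\<dots> \<ge> m * m" using m by (intro mult_mono b pq) auto
  finally have "m\<^sup>2 \<le> \<bar>shift_monomial {p, q} \<theta>\<bar>" by (simp add: power2_eq_square)
  moreover have "\<bar>shift_monomial {p, q} \<theta> - shift_monomial {p, q} \<phi>\<bar> \<le> \<Delta>"
    using pq by (intro close) auto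
  \<comment> \<open>The bound \<open>m ^ 2\<close> on \<open>\<Delta>\<close> enters here, the bound
    \<open>m ^ 3\<close> in the comparison of the supports.\<close>
  ultimately have "shift_monomial {p, q} \<phi> \<noteq> 0" using small by auto
  then obtain r where r: "(\<lambda>j. j + r) ` {p, q} \<subseteq> supp \<phi>" by (rule shift_monomial_nonzeroD)
  \<comment> \<open>Aligning \<open>\<phi>\<close> puts the same pair into both supports. The
    monomials do not see the shift, and \<open>orbit_dist_le\<close> undoes it at the end.\<close>
  define \<psi> where "\<psi> = shift r \<phi>"
  have \<psi>: "bounded_collision_free m M \<psi>" "collision_free \<psi>" and pq': "p \<in> supp \<psi>" "q \<in> supp \<psi>"
    using bounded_collision_free_shift[OF \<phi>] r
    by (auto simp: \<psi>_def bounded_collision_free_def) (auto simp: supp_def shift_def)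
  have close': "\<bar>shift_monomial J \<theta> - shift_monomial J \<psi>\<bar> \<le> \<Delta>" if "2 \<le> card J" "card J \<le> 3" for J
    using close[OF that] by (simp add: \<psi>_def)
  have S: "supp \<psi> = supp \<theta>"
  proof
    show "supp \<theta> \<subseteq> supp \<psi>"
      using close' small by (intro moments_determine_support[OF \<theta> \<psi>(2) m pq pq']) (auto intro: le_less_trans)
    show "supp \<psi> \<subseteq> supp \<theta>"
    proof (rule moments_determine_support[OF \<psi>(1) cf m pq(1) pq' pq(2,3)])
      fix J :: "'l mod_ring set" assume "2 \<le> card J" "card J \<le> 3"
      thus "\<bar>shift_monomial J \<psi> - shift_monomial J \<theta>\<bar> < m ^ 3"
        using close'[of J] small by (simp add: abs_minus_commute)
    qed
  qed
  have \<Delta>: "0 \<le> \<Delta>" using close[of "{p, q}"] pq by force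
  have coord: "\<bar>(\<psi> - \<theta>) $ k\<bar> \<le> (1 + M) / m\<^sup>2 * \<Delta>" for k
  proof (cases "k \<in> supp \<theta>")
    case True
    thus ?thesis using moments_determine_values[OF \<theta> \<psi>(1) m S close' True]
      by (simp add: abs_minus_commute)
  next
    case False
    hence "\<theta> $ k = 0" "\<psi> $ k = 0" using S by (auto simp: supp_def)
    thus ?thesis using \<Delta> m M by simp
  qed
  have "orbit_dist \<phi> \<theta> \<le> norm (\<psi> - \<theta>)" unfolding \<psi>_def by (rule orbit_dist_le)
  also have "\<dots> \<le> (\<Sum>k\<in>UNIV. \<bar>(\<psi> - \<theta>) $ k\<bar>)" by (rule norm_le_l1_cart)
  also have "\<dots> \<le> (\<Sum>k\<in>(UNIV::'l mod_ring set). (1 + M) / m\<^sup>2 * \<Delta>)" by (intro sum_mono coord)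
  finally show ?thesis by simp
qed

text \<open>For \<open>\<Delta>\<close> above the threshold, the trivial bound 2 M L on the distance
  is itself at most a multiple of \<open>\<Delta>\<close>. The sum of the two constants covers both
  cases.\<close>

lemma orbit_dist_le_moments_global:
  assumes m: "0 < m" and M: "0 < M"
  obtains K where "K > 0" and
    "\<And>\<theta> \<phi> \<Delta>. bounded_collision_free m M \<theta> \<Longrightarrow> bounded_collision_free m M (\<phi> :: 'l::finite signal) \<Longrightarrow> 0 \<le> \<Delta> \<Longrightarrow>
      (\<And>J. 2 \<le> card J \<Longrightarrow> card J \<le> 3 \<Longrightarrow> \<bar>shift_monomial J \<theta> - shift_monomial J \<phi>\<bar> \<le> \<Delta>) \<Longrightarrow>
      orbit_dist \<phi> \<theta> \<le> K * \<Delta>"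
proof
  let ?L = "real CARD('l)" and ?\<kappa> = "min (m\<^sup>2) (m ^ 3)"
  let ?K = "?L * ((1 + M) / m\<^sup>2) + ?L * (2 * M) / ?\<kappa>"
  have \<kappa>: "?\<kappa> > 0" using m by simp
  have pos: "?L * ((1 + M) / m\<^sup>2) > 0" "?L * (2 * M) / ?\<kappa> > 0" using m M by auto
  thus "?K > 0" by linarith
  fix \<theta> \<phi> :: "'l signal" and \<Delta> :: real
  assume \<theta>: "bounded_collision_free m M \<theta>" and \<phi>: "bounded_collision_free m M \<phi>" and \<Delta>: "0 \<le> \<Delta>"
    and close: "\<And>J. 2 \<le> card J \<Longrightarrow> card J \<le> 3 \<Longrightarrow> \<bar>shift_monomial J \<theta> - shift_monomial J \<phi>\<bar> \<le> \<Delta>"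
  show "orbit_dist \<phi> \<theta> \<le> ?K * \<Delta>"
  proof (cases "\<Delta> < ?\<kappa>")
    case True
    have "orbit_dist \<phi> \<theta> \<le> ?L * ((1 + M) / m\<^sup>2 * \<Delta>)"
      by (rule orbit_dist_le_moments[OF \<theta> \<phi> m M close True])
    also have "\<dots> \<le> ?K * \<Delta>"
      unfolding mult.assoc[symmetric] using pos \<Delta> by (intro mult_right_mono) auto
    finally show ?thesis .
  next
    case False
    have coord: "\<bar>\<theta> $ k\<bar> \<le> M" "\<bar>\<phi> $ k\<bar> \<le> M" for k
      using \<theta> \<phi> M by (cases "\<theta> $ k = 0"; cases "\<phi> $ k = 0"; force simp: bounded_collision_free_def supp_def)+
    have "orbit_dist \<phi> \<theta> \<le> norm (shift 0 \<phi> - \<theta>)" by (rule orbit_dist_le)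
    also have "\<dots> \<le> (\<Sum>k\<in>UNIV. \<bar>(\<phi> - \<theta>) $ k\<bar>)" using norm_le_l1_cart[of "\<phi> - \<theta>"] by simp
    also have "\<dots> \<le> (\<Sum>k\<in>(UNIV::'l mod_ring set). 2 * M)"
    proof (rule sum_mono)
      fix k show "\<bar>(\<phi> - \<theta>) $ k\<bar> \<le> 2 * M" using coord[of k] by simp
    qed
    also have "\<dots> = ?L * (2 * M) / ?\<kappa> * ?\<kappa>" using less_imp_neq[OF \<kappa>] by (simp del: min_less_iff_conj)
    also have "\<dots> \<le> ?K * \<Delta>" using False pos \<kappa> by (intro mult_mono) auto
    finally show ?thesis .
  qed
qed


section \<open>The standard Gaussian law\<close>

abbreviation std_normal :: "real measure" where
  "std_normal \<equiv> density lborel (\<lambda>x. ennreal (std_normal_density x))"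

lemma prob_space_std_normal: "prob_space std_normal"
  by (rule prob_space_normal_density) simp

lemma sets_std_normal [measurable_cong]: "sets std_normal = sets borel"
  by simp

text \<open>The one-dimensional Cameron-Martin formula: the weight is the quotient of the densities
  of N(c, 1) and N(0, 1).\<close>

lemma std_normal_translate:
  "distr std_normal std_normal (\<lambda>x. c + x) = density std_normal (\<lambda>x. ennreal (exp (c * x - c\<^sup>2 / 2)))"
proof -
  interpret prob_space std_normal by (rule prob_space_std_normal)
  have "distributed std_normal lborel (\<lambda>x. x) (normal_density 0 1)"
    unfolding distributed_def by (auto simp: distr_id2)
  from normal_density_affine[OF this, of 1 c]
  have "distributed std_normal lborel (\<lambda>x. c + x) (normal_density c 1)" by simp
  hence "distr std_normal lborel (\<lambda>x. c + x) = density lborel (\<lambda>x. ennreal (normal_density c 1 x))"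
    by (simp add: distributed_def)
  moreover have "distr std_normal std_normal (\<lambda>x. c + x) = distr std_normal lborel (\<lambda>x. c + x)"
    by (intro distr_cong) auto
  moreover have "normal_density c 1 x = std_normal_density x * exp (c * x - c\<^sup>2 / 2)" for x
    by (simp add: normal_density_def exp_add[symmetric] power2_eq_square algebra_simps
                  add_divide_distrib diff_divide_distrib)
  ultimately show ?thesis
    by (subst density_density_eq) (simp_all add: ennreal_mult)
qed

text \<open>The integrand is the density of a translated probability law, so its integral is the
  total mass.\<close>

lemma nn_integral_exp_std_normal: "(\<integral>\<^sup>+x. ennreal (exp (c * x - c\<^sup>2 / 2)) \<partial>std_normal) = 1"
proof -
  interpret prob_space std_normal by (rule prob_space_std_normal)
  have "prob_space (distr std_normal std_normal (\<lambda>x. c + x))"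
    by (rule prob_space_distr) simp
  hence "emeasure (density std_normal (\<lambda>x. ennreal (exp (c * x - c\<^sup>2 / 2)))) UNIV = 1"
    unfolding std_normal_translate by (auto dest: prob_space.emeasure_space_1)
  thus ?thesis by (subst (asm) emeasure_density) auto
qed

lemma integrable_exp_std_normal: "integrable std_normal (\<lambda>x. exp (c * x))"
proof -
  have "integrable std_normal (\<lambda>x. exp (c * x - c\<^sup>2 / 2))"
    using nn_integral_exp_std_normal[of c] by (intro integrableI_bounded) auto
  hence "integrable std_normal (\<lambda>x. exp (c\<^sup>2 / 2) * exp (c * x - c\<^sup>2 / 2))"
    by (rule integrable_mult_right)
  thus ?thesis by (simp add: exp_add[symmetric])
qed

lemma integrable_exp_abs_std_normal: "integrable std_normal (\<lambda>x. exp \<bar>x\<bar>)"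
proof (rule Bochner_Integration.integrable_bound)
  show "integrable std_normal (\<lambda>x. exp (1 * x) + exp ((-1) * x))"
    by (intro Bochner_Integration.integrable_add integrable_exp_std_normal)
  show "AE x in std_normal. norm (exp \<bar>x\<bar>) \<le> norm (exp (1 * x) + exp ((-1) * x))"
  proof (rule AE_I2)
    fix x :: real
    have "exp \<bar>x\<bar> \<le> exp (1 * x) + exp ((-1) * x)" by (cases "x < 0") auto
    thus "norm (exp \<bar>x\<bar>) \<le> norm (exp (1 * x) + exp ((-1) * x))"
      by (metis abs_exp_cancel abs_ge_self order_trans real_norm_def)
  qed
qed auto

lemma integrable_std_normal: "integrable std_normal (\<lambda>x. x)" and integral_std_normal: "(\<integral>x. x \<partial>std_normal) = 0"
proof -
  have *: "has_bochner_integral lborel (\<lambda>x. std_normal_density x * x) 0"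
    using std_normal_moment_odd[of 0] by simp
  show "integrable std_normal (\<lambda>x. x)"
    using * by (subst integrable_density) (auto simp: has_bochner_integral_iff)
  show "(\<integral>x. x \<partial>std_normal) = 0"
    using * by (subst integral_density) (auto simp: has_bochner_integral_iff)
qed

section \<open>Independent coordinates\<close>

interpretation std_normal: prob_space std_normal
  by (rule prob_space_std_normal)

interpretation std_normal_product: product_prob_space "\<lambda>_::'i. std_normal" "UNIV :: 'i set"
  by (intro product_prob_spaceI prob_space_std_normal)

lemma measurable_vec_lambda [measurable]:
  "vec_lambda \<in> measurable (\<Pi>\<^sub>M i\<in>(UNIV :: 'n::finite set). std_normal) (borel :: (real ^ 'n) measure)"
proof (subst borel_measurable_euclidean_space, rule ballI)
  fix b :: "real ^ 'n" assume "b \<in> Basis"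
  then obtain i where b: "b = axis i 1" by (auto simp: Basis_vec_def)
  have "(\<lambda>x. x i) \<in> measurable (\<Pi>\<^sub>M i\<in>(UNIV :: 'n set). std_normal) std_normal"
    by (rule measurable_component_singleton) simp
  thus "(\<lambda>x. vec_lambda x \<bullet> b) \<in> borel_measurable (\<Pi>\<^sub>M i\<in>(UNIV :: 'n set). std_normal)"
    by (simp add: b inner_axis measurable_cong_sets[OF refl sets_std_normal])
qed

lemma sets_std_gaussian [measurable_cong]: "sets std_gaussian = sets borel"
  by (simp add: std_gaussian_def)

lemma space_std_gaussian [simp]: "space std_gaussian = UNIV"
  by (simp add: std_gaussian_def)

lemma measurable_std_gaussian [simp]: "borel_measurable std_gaussian = borel_measurable borel"
  by (rule measurable_cong_sets) (simp_all add: sets_std_gaussian)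

interpretation std_gaussian: prob_space std_gaussian
  unfolding std_gaussian_def
  by (intro prob_space.prob_space_distr prob_space_PiM prob_space_std_normal) simp

lemma integrable_std_gaussian_prod:
  fixes f :: "'l::finite mod_ring \<Rightarrow> real \<Rightarrow> real"
  assumes "\<And>i. integrable std_normal (f i)"
  shows "integrable std_gaussian (\<lambda>\<xi>. \<Prod>i\<in>UNIV. f i (\<xi> $ i))"
    and "(\<integral>\<xi>. (\<Prod>i\<in>UNIV. f i (\<xi> $ i)) \<partial>std_gaussian) = (\<Prod>i\<in>UNIV. \<integral>x. f i x \<partial>std_normal)"
proof -
  have [measurable]: "f i \<in> borel_measurable borel" for i
    using borel_measurable_integrable[OF assms, of i] by simp
  show "integrable std_gaussian (\<lambda>\<xi>. \<Prod>i\<in>UNIV. f i (\<xi> $ i))"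
    unfolding std_gaussian_def
    using std_normal_product.product_integrable_prod[of UNIV f, OF _ assms]
    by (subst integrable_distr_eq) auto
  show "(\<integral>\<xi>. (\<Prod>i\<in>UNIV. f i (\<xi> $ i)) \<partial>std_gaussian) = (\<Prod>i\<in>UNIV. \<integral>x. f i x \<partial>std_normal)"
    unfolding std_gaussian_def
    using std_normal_product.product_integral_prod[of UNIV f, OF _ assms]
    by (subst integral_distr) auto
qed

text \<open>The Euclidean norm is at most the sum of the absolute coordinates, so independence
  reduces the claim to one dimension. This exponential dominates the integrands of the later moment
  and tilting estimates.\<close>

lemma integrable_exp_norm_std_gaussian: "integrable std_gaussian (\<lambda>\<xi>. exp (norm \<xi>))"
proof (rule Bochner_Integration.integrable_bound)
  show "integrable std_gaussian (\<lambda>\<xi>. \<Prod>i\<in>UNIV. exp \<bar>\<xi> $ i\<bar>)"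
    by (rule integrable_std_gaussian_prod) (rule integrable_exp_abs_std_normal)
  show "AE \<xi> in std_gaussian. norm (exp (norm \<xi>)) \<le> norm (\<Prod>i\<in>UNIV. exp \<bar>\<xi> $ i\<bar>)"
    by (rule AE_I2) (simp add: exp_sum[symmetric] norm_le_l1_cart)
qed auto

text \<open>By independence the mean of a product over distinct coordinates is the product of the
  means, and centred noise leaves no bias.\<close>

lemma std_gaussian_mean_prod:
  fixes y :: "'l::finite signal"
  shows "integrable std_gaussian (\<lambda>\<xi>. \<Prod>k\<in>K. (y + \<sigma> *\<^sub>R \<xi>) $ k)"
    and "(\<integral>\<xi>. (\<Prod>k\<in>K. (y + \<sigma> *\<^sub>R \<xi>) $ k) \<partial>std_gaussian) = (\<Prod>k\<in>K. y $ k)"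
proof -
  \<comment> \<open>Factors 1 outside \<open>K\<close> extend the product to all
    coordinates.\<close>
  define f where "f k x = (if k \<in> K then y $ k + \<sigma> * x else 1)" for k x
  have eq: "(\<Prod>k\<in>K. (y + \<sigma> *\<^sub>R \<xi>) $ k) = (\<Prod>k\<in>UNIV. f k (\<xi> $ k))" for \<xi>
    unfolding f_def by (intro prod.mono_neutral_cong_left) auto
  have int: "integrable std_normal (f k)" for k
    unfolding f_def by (cases "k \<in> K") (auto intro!: Bochner_Integration.integrable_add integrable_mult_right integrable_std_normal)
  have mean: "(\<integral>x. f k x \<partial>std_normal) = (if k \<in> K then y $ k else 1)" for k
    unfolding f_def using integrable_std_normal integral_std_normal std_normal.prob_space
    by (cases "k \<in> K") (simp_all)
  show "integrable std_gaussian (\<lambda>\<xi>. \<Prod>k\<in>K. (y + \<sigma> *\<^sub>R \<xi>) $ k)"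
    unfolding eq by (rule integrable_std_gaussian_prod[OF int])
  show "(\<integral>\<xi>. (\<Prod>k\<in>K. (y + \<sigma> *\<^sub>R \<xi>) $ k) \<partial>std_gaussian) = (\<Prod>k\<in>K. y $ k)"
    unfolding eq integrable_std_gaussian_prod(2)[OF int] mean
    by (intro prod.mono_neutral_cong_right) auto
qed

section \<open>Translating the Gaussian law\<close>

definition translate_density :: "'l::finite signal \<Rightarrow> 'l signal \<Rightarrow> real" where
  "translate_density a \<xi> = exp (a \<bullet> \<xi> - (norm a)\<^sup>2 / 2)"

lemma measurable_translate_density [measurable]: "translate_density a \<in> borel_measurable borel"
  unfolding translate_density_def by measurable

text \<open>The Cameron-Martin formula in dimension L. The translated and the weighted product law
  both give a box the product of the one-dimensional masses of \<open>std_normal_translate\<close>,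
  so both are the product of those laws.\<close>

lemma std_gaussian_translate:
  fixes a :: "'l::finite signal"
  shows "distr std_gaussian std_gaussian (\<lambda>\<xi>. a + \<xi>) = density std_gaussian (\<lambda>\<xi>. ennreal (translate_density a \<xi>))"
proof -
  let ?P = "\<Pi>\<^sub>M i\<in>(UNIV :: 'l mod_ring set). std_normal"
  let ?T = "\<lambda>x i. a $ i + x i"
  let ?e = "\<lambda>i x. ennreal (exp (a $ i * x - (a $ i)\<^sup>2 / 2))"
  have T [measurable]: "?T \<in> measurable ?P ?P"
    by (rule measurable_PiM_single') (auto simp: space_PiM)
  let ?N = "\<lambda>i. density std_normal (?e i)"
  have N: "?N i = distr std_normal std_normal (\<lambda>x. a $ i + x)" for i
    by (simp add: std_normal_translate)
  have pN: "prob_space (?N i)" for i unfolding N by (rule std_normal.prob_space_distr) simp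
  interpret N: product_prob_space ?N UNIV
    by (intro product_prob_spaceI pN)
  have sN: "sets (PiM UNIV ?N) = sets ?P" by (intro sets_PiM_cong) auto
  have 1: "distr ?P ?P ?T = PiM UNIV ?N"
  proof (rule N.PiM_eqI)
    fix A assume A: "\<And>i. i \<in> UNIV \<Longrightarrow> A i \<in> sets (?N i)"
    hence A' [measurable]: "A i \<in> sets borel" for i by simp
    have "emeasure (distr ?P ?P ?T) (Pi\<^sub>E UNIV A) = emeasure ?P (?T -` Pi\<^sub>E UNIV A \<inter> space ?P)"
      using A by (intro emeasure_distr sets_PiM_I_finite) auto
    also have "?T -` Pi\<^sub>E UNIV A \<inter> space ?P = Pi\<^sub>E UNIV (\<lambda>i. (\<lambda>x. a $ i + x) -` A i \<inter> space std_normal)"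
      by (auto simp: space_PiM PiE_def Pi_def)
    also have "emeasure ?P \<dots> = (\<Prod>i\<in>UNIV. emeasure std_normal ((\<lambda>x. a $ i + x) -` A i \<inter> space std_normal))"
      by (intro std_normal_product.emeasure_PiM measurable_sets[of _ std_normal std_normal]) auto
    also have "\<dots> = (\<Prod>i\<in>UNIV. emeasure (?N i) (A i))"
      unfolding N by (intro prod.cong refl emeasure_distr[symmetric]) auto
    finally show "emeasure (distr ?P ?P ?T) (Pi\<^sub>E UNIV A) = (\<Prod>i\<in>UNIV. emeasure (?N i) (A i))" .
  qed (auto simp: sN)
  have 2: "density ?P (\<lambda>x. \<Prod>i\<in>UNIV. ?e i (x i)) = PiM UNIV ?N"
  proof (rule N.PiM_eqI)
    fix A assume A: "\<And>i. i \<in> UNIV \<Longrightarrow> A i \<in> sets (?N i)"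
    hence A' [measurable]: "A i \<in> sets borel" for i by simp
    have ind: "indicator (Pi\<^sub>E UNIV A) x = (\<Prod>i\<in>UNIV. indicator (A i) (x i) :: ennreal)" for x
      by (auto simp: indicator_def PiE_def Pi_def prod_eq_1_iff intro!: prod_zero[symmetric])
    have "emeasure (density ?P (\<lambda>x. \<Prod>i\<in>UNIV. ?e i (x i))) (Pi\<^sub>E UNIV A)
       = (\<integral>\<^sup>+x. (\<Prod>i\<in>UNIV. ?e i (x i)) * indicator (Pi\<^sub>E UNIV A) x \<partial>?P)"
      using A by (intro emeasure_density sets_PiM_I_finite) auto
    also have "\<dots> = (\<integral>\<^sup>+x. (\<Prod>i\<in>UNIV. ?e i (x i) * indicator (A i) (x i)) \<partial>?P)"
      by (simp add: ind prod.distrib)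
    also have "\<dots> = (\<Prod>i\<in>UNIV. \<integral>\<^sup>+x. ?e i x * indicator (A i) x \<partial>std_normal)"
      by (intro std_normal_product.product_nn_integral_prod) auto
    also have "\<dots> = (\<Prod>i\<in>UNIV. emeasure (?N i) (A i))"
      by (intro prod.cong refl emeasure_density[symmetric]) auto
    finally show "emeasure (density ?P (\<lambda>x. \<Prod>i\<in>UNIV. ?e i (x i))) (Pi\<^sub>E UNIV A) = (\<Prod>i\<in>UNIV. emeasure (?N i) (A i))" .
  qed (auto simp: sN)
  have e: "(\<Prod>i\<in>UNIV. ?e i (x i)) = ennreal (translate_density a (vec_lambda x))" for x
    by (simp add: prod_ennreal translate_density_def inner_vec_def norm_vec_def L2_set_def
        exp_sum[symmetric] sum_subtractf sum_divide_distrib sum_nonneg)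
  have "distr std_gaussian std_gaussian (\<lambda>\<xi>. a + \<xi>) = distr std_gaussian borel (\<lambda>\<xi>. a + \<xi>)"
    by (intro distr_cong) (auto simp: sets_std_gaussian)
  also have "\<dots> = distr ?P borel (\<lambda>x. a + vec_lambda x)"
    unfolding std_gaussian_def by (subst distr_distr) (auto simp: o_def)
  also have "\<dots> = distr (distr ?P ?P ?T) borel vec_lambda"
    by (subst distr_distr) (auto simp: o_def vec_eq_iff intro!: distr_cong)
  also have "\<dots> = distr (density ?P (\<lambda>x. ennreal (translate_density a (vec_lambda x)))) borel vec_lambda"
    unfolding 1 2[symmetric] e ..
  also have "\<dots> = density (distr ?P borel vec_lambda) (\<lambda>\<xi>. ennreal (translate_density a \<xi>))"
    by (rule density_distr[symmetric]) auto
  finally show ?thesis by (simp add: std_gaussian_def)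
qed

lemma nn_integral_std_gaussian_translate:
  assumes [measurable]: "f \<in> borel_measurable borel"
  shows "(\<integral>\<^sup>+\<xi>. f (a + \<xi>) \<partial>std_gaussian) = (\<integral>\<^sup>+\<xi>. f \<xi> * ennreal (translate_density a \<xi>) \<partial>std_gaussian)"
proof -
  have "(\<integral>\<^sup>+\<xi>. f (a + \<xi>) \<partial>std_gaussian) = (\<integral>\<^sup>+\<xi>. f \<xi> \<partial>distr std_gaussian std_gaussian (\<lambda>\<xi>. a + \<xi>))"
    by (subst nn_integral_distr) auto
  thus ?thesis unfolding std_gaussian_translate
    by (subst (asm) nn_integral_density) (auto simp: mult.commute)
qed

lemma integral_std_gaussian_translate:
  fixes f :: "'l::finite signal \<Rightarrow> real"
  assumes [measurable]: "f \<in> borel_measurable borel"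
  shows "integrable std_gaussian (\<lambda>\<xi>. f (a + \<xi>)) \<longleftrightarrow> integrable std_gaussian (\<lambda>\<xi>. f \<xi> * translate_density a \<xi>)"
    and "(\<integral>\<xi>. f (a + \<xi>) \<partial>std_gaussian) = (\<integral>\<xi>. f \<xi> * translate_density a \<xi> \<partial>std_gaussian)"
proof -
  have nn: "AE \<xi> in std_gaussian. 0 \<le> translate_density a \<xi>" by (simp add: translate_density_def)
  have "integrable std_gaussian (\<lambda>\<xi>. f (a + \<xi>)) \<longleftrightarrow> integrable (distr std_gaussian std_gaussian (\<lambda>\<xi>. a + \<xi>)) f"
    by (subst integrable_distr_eq) auto
  thus "integrable std_gaussian (\<lambda>\<xi>. f (a + \<xi>)) \<longleftrightarrow> integrable std_gaussian (\<lambda>\<xi>. f \<xi> * translate_density a \<xi>)"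
    unfolding std_gaussian_translate by (subst (asm) integrable_density[OF _ _ nn]) (auto simp: mult.commute)
  have "(\<integral>\<xi>. f (a + \<xi>) \<partial>std_gaussian) = (\<integral>\<xi>. f \<xi> \<partial>distr std_gaussian std_gaussian (\<lambda>\<xi>. a + \<xi>))"
    by (subst integral_distr) auto
  thus "(\<integral>\<xi>. f (a + \<xi>) \<partial>std_gaussian) = (\<integral>\<xi>. f \<xi> * translate_density a \<xi> \<partial>std_gaussian)"
    unfolding std_gaussian_translate by (subst (asm) integral_density[OF _ _ nn]) (auto simp: mult.commute)
qed


section \<open>Likelihood ratios and the Hellinger distance\<close>

text \<open>The density of the rescaled observation \<open>X / \<sigma>\<close> with respect to the standard normal law.\<close>

definition likelihood_ratio :: "real \<Rightarrow> 'l::finite signal \<Rightarrow> 'l signal \<Rightarrow> real" where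
  "likelihood_ratio \<sigma> \<theta> \<xi> =
     (\<Sum>G\<in>cyclic_shifts. translate_density ((1 / \<sigma>) *\<^sub>R G \<theta>) \<xi>) / real (card (cyclic_shifts :: ('l signal \<Rightarrow> _) set))"

lemma measurable_likelihood_ratio [measurable]: "likelihood_ratio \<sigma> \<theta> \<in> borel_measurable borel"
  unfolding likelihood_ratio_def by measurable

lemma likelihood_ratio_pos: "0 < likelihood_ratio \<sigma> \<theta> \<xi>"
  unfolding likelihood_ratio_def
  by (intro divide_pos_pos sum_pos) (auto simp: translate_density_def)

section \<open>The law of an observation as a Gaussian mixture\<close>

lemma measurable_sample_map [measurable]:
  "(\<lambda>(G, \<xi>). G \<theta> + \<sigma> *\<^sub>R \<xi>) \<in> measurable (measure_pmf p \<Otimes>\<^sub>M std_gaussian) (borel :: ('l::finite signal) measure)"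
proof -
  have [measurable]: "(\<lambda>x. fst x \<theta>) \<in> measurable (measure_pmf p \<Otimes>\<^sub>M std_gaussian) (borel :: 'l signal measure)"
    by (rule measurable_compose[OF measurable_fst]) simp
  have [measurable]: "snd \<in> measurable (measure_pmf p \<Otimes>\<^sub>M std_gaussian) (borel :: 'l signal measure)"
    using measurable_snd[of "measure_pmf p" std_gaussian]
    by (simp add: measurable_cong_sets[OF refl sets_std_gaussian])
  show ?thesis unfolding case_prod_beta by measurable
qed

text \<open>Rescaling by \<open>\<sigma>\<close> and translating each component of the mixture
  refers every \<open>sample_law\<close> to the same Gaussian measure, which makes different signals
  comparable.\<close>

lemma nn_integral_sample_law:
  fixes f :: "'l::finite signal \<Rightarrow> ennreal"
  assumes [measurable]: "f \<in> borel_measurable borel" and \<sigma>: "0 < \<sigma>"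
  shows "(\<integral>\<^sup>+x. f x \<partial>sample_law \<sigma> \<theta>) =
    (\<integral>\<^sup>+\<xi>. f (\<sigma> *\<^sub>R \<xi>) * ennreal (likelihood_ratio \<sigma> \<theta> \<xi>) \<partial>std_gaussian)"
proof -
  let ?N = "real (card (cyclic_shifts :: ('l signal \<Rightarrow> _) set))"
  have N: "?N > 0" by simp
  have shifted: "(\<integral>\<^sup>+\<xi>. f (G \<theta> + \<sigma> *\<^sub>R \<xi>) \<partial>std_gaussian) =
    (\<integral>\<^sup>+\<xi>. f (\<sigma> *\<^sub>R \<xi>) * ennreal (translate_density ((1 / \<sigma>) *\<^sub>R G \<theta>) \<xi>) \<partial>std_gaussian)" for G :: "'l signal \<Rightarrow> 'l signal"
    using nn_integral_std_gaussian_translate[of "\<lambda>\<xi>. f (\<sigma> *\<^sub>R \<xi>)" "(1 / \<sigma>) *\<^sub>R G \<theta>"] \<sigma>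
    by (simp add: scaleR_add_right)
  have "(\<integral>\<^sup>+x. f x \<partial>sample_law \<sigma> \<theta>) =
    (\<integral>\<^sup>+(G, \<xi>). f (G \<theta> + \<sigma> *\<^sub>R \<xi>) \<partial>(measure_pmf (pmf_of_set cyclic_shifts) \<Otimes>\<^sub>M std_gaussian))"
    unfolding sample_law_def by (subst nn_integral_distr) (auto simp: case_prod_unfold)
  also have "\<dots> = (\<integral>\<^sup>+G. \<integral>\<^sup>+\<xi>. f (G \<theta> + \<sigma> *\<^sub>R \<xi>) \<partial>std_gaussian \<partial>measure_pmf (pmf_of_set cyclic_shifts))"
  proof -
    have "(\<lambda>x. f ((\<lambda>(G, \<xi>). G \<theta> + \<sigma> *\<^sub>R \<xi>) x)) \<in> borel_measurable (measure_pmf (pmf_of_set cyclic_shifts) \<Otimes>\<^sub>M std_gaussian)"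
      by (rule measurable_compose[OF measurable_sample_map]) simp
    from std_gaussian.nn_integral_fst[OF this] show ?thesis by (simp add: case_prod_unfold)
  qed
  also have "\<dots> = (\<Sum>G\<in>cyclic_shifts. \<integral>\<^sup>+\<xi>. f (G \<theta> + \<sigma> *\<^sub>R \<xi>) \<partial>std_gaussian) / of_nat (card (cyclic_shifts :: ('l signal \<Rightarrow> _) set))"
    by (subst nn_integral_pmf_of_set) auto
  also have "\<dots> = (\<Sum>G\<in>cyclic_shifts. \<integral>\<^sup>+\<xi>. f (\<sigma> *\<^sub>R \<xi>) * ennreal (translate_density ((1 / \<sigma>) *\<^sub>R G \<theta>) \<xi>) \<partial>std_gaussian) * ennreal (1 / ?N)"
    unfolding shifted divide_ennreal_def using N
    by (simp only: inverse_ennreal ennreal_of_nat_eq_real_of_nat inverse_eq_divide)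
  also have "\<dots> = (\<integral>\<^sup>+\<xi>. f (\<sigma> *\<^sub>R \<xi>) * ennreal (likelihood_ratio \<sigma> \<theta> \<xi>) \<partial>std_gaussian)"
  proof -
    have tp: "0 \<le> translate_density a \<xi>" for a \<xi> :: "'l signal" by (simp add: translate_density_def)
    have "ennreal (likelihood_ratio \<sigma> \<theta> \<xi>) =
        (\<Sum>G\<in>cyclic_shifts. ennreal (translate_density ((1 / \<sigma>) *\<^sub>R G \<theta>) \<xi>)) * ennreal (1 / ?N)" for \<xi>
      unfolding sum_ennreal[OF tp] by (subst ennreal_mult[symmetric]) (auto simp: likelihood_ratio_def tp sum_nonneg)
    hence "f (\<sigma> *\<^sub>R \<xi>) * ennreal (likelihood_ratio \<sigma> \<theta> \<xi>) =
        (\<Sum>G\<in>cyclic_shifts. f (\<sigma> *\<^sub>R \<xi>) * ennreal (translate_density ((1 / \<sigma>) *\<^sub>R G \<theta>) \<xi>)) * ennreal (1 / ?N)" for \<xi>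
      by (simp only: sum_distrib_left[symmetric] mult.assoc)
    thus ?thesis by (simp add: nn_integral_multc nn_integral_sum)
  qed
  finally show ?thesis .
qed

lemma prob_space_sample_law: "prob_space (sample_law \<sigma> \<theta>)"
proof -
  interpret pair_prob_space "measure_pmf (pmf_of_set cyclic_shifts)" std_gaussian ..
  show ?thesis unfolding sample_law_def by (rule prob_space_distr) simp
qed

lemma sets_sample_law [simp, measurable_cong]: "sets (sample_law \<sigma> \<theta>) = sets borel"
  by (simp add: sample_law_def)

text \<open>The counterpart for real integrands. Integrability is asked of each mixture component,
  before the change of measure.\<close>

lemma likelihood_ratio_integral:
  fixes f :: "'l::finite signal \<Rightarrow> real"
  assumes [measurable]: "f \<in> borel_measurable borel" and \<sigma>: "0 < \<sigma>"
    and int: "\<And>G. G \<in> cyclic_shifts \<Longrightarrow> integrable std_gaussian (\<lambda>\<xi>. f (G \<theta> + \<sigma> *\<^sub>R \<xi>))"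
  shows "integrable std_gaussian (\<lambda>\<xi>. f (\<sigma> *\<^sub>R \<xi>) * likelihood_ratio \<sigma> \<theta> \<xi>)"
    and "(\<integral>\<xi>. f (\<sigma> *\<^sub>R \<xi>) * likelihood_ratio \<sigma> \<theta> \<xi> \<partial>std_gaussian) =
      (\<Sum>G\<in>cyclic_shifts. \<integral>\<xi>. f (G \<theta> + \<sigma> *\<^sub>R \<xi>) \<partial>std_gaussian) / real (card (cyclic_shifts :: ('l signal \<Rightarrow> _) set))"
proof -
  have eq: "f (\<sigma> *\<^sub>R \<xi>) * likelihood_ratio \<sigma> \<theta> \<xi> =
    (\<Sum>G\<in>cyclic_shifts. f (\<sigma> *\<^sub>R \<xi>) * translate_density ((1 / \<sigma>) *\<^sub>R G \<theta>) \<xi>) / real (card (cyclic_shifts :: ('l signal \<Rightarrow> _) set))" for \<xi>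
    by (simp add: likelihood_ratio_def sum_distrib_left)
  have "f (\<sigma> *\<^sub>R ((1 / \<sigma>) *\<^sub>R G \<theta> + \<xi>)) = f (G \<theta> + \<sigma> *\<^sub>R \<xi>)" for G :: "'l signal \<Rightarrow> 'l signal" and \<xi>
    using \<sigma> by (simp add: scaleR_add_right)
  note tr = integral_std_gaussian_translate[of "\<lambda>\<xi>. f (\<sigma> *\<^sub>R \<xi>)" "(1 / \<sigma>) *\<^sub>R G \<theta>" for G, unfolded this]
  have int': "integrable std_gaussian (\<lambda>\<xi>. f (\<sigma> *\<^sub>R \<xi>) * translate_density ((1 / \<sigma>) *\<^sub>R G \<theta>) \<xi>)"
    if "G \<in> cyclic_shifts" for G
    using tr(1)[of G] int[OF that] by simp
  show "integrable std_gaussian (\<lambda>\<xi>. f (\<sigma> *\<^sub>R \<xi>) * likelihood_ratio \<sigma> \<theta> \<xi>)"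
    unfolding eq by (intro integrable_divide_zero Bochner_Integration.integrable_sum int')
  show "(\<integral>\<xi>. f (\<sigma> *\<^sub>R \<xi>) * likelihood_ratio \<sigma> \<theta> \<xi> \<partial>std_gaussian) =
      (\<Sum>G\<in>cyclic_shifts. \<integral>\<xi>. f (G \<theta> + \<sigma> *\<^sub>R \<xi>) \<partial>std_gaussian) / real (card (cyclic_shifts :: ('l signal \<Rightarrow> _) set))"
    unfolding eq using int' tr(2) by (simp add: Bochner_Integration.integral_sum)
qed

text \<open>Shifts keep the norm, so in applications one \<open>g\<close> bounds all components of
  the mixture, and the average of equal bounds is again that bound.\<close>

lemma likelihood_ratio_integral_le:
  fixes f g :: "'l::finite signal \<Rightarrow> real"
  assumes f: "f \<in> borel_measurable borel" and \<sigma>: "0 < \<sigma>"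
    and g: "integrable std_gaussian g"
    and bound: "\<And>G \<xi>. G \<in> cyclic_shifts \<Longrightarrow> \<bar>f (G \<theta> + \<sigma> *\<^sub>R \<xi>)\<bar> \<le> g \<xi>"
  shows "integrable std_gaussian (\<lambda>\<xi>. f (\<sigma> *\<^sub>R \<xi>) * likelihood_ratio \<sigma> \<theta> \<xi>)"
    and "(\<integral>\<xi>. f (\<sigma> *\<^sub>R \<xi>) * likelihood_ratio \<sigma> \<theta> \<xi> \<partial>std_gaussian) \<le> (\<integral>\<xi>. g \<xi> \<partial>std_gaussian)"
proof -
  note f [measurable]
  let ?N = "real (card (cyclic_shifts :: ('l signal \<Rightarrow> _) set))"
  have int: "integrable std_gaussian (\<lambda>\<xi>. f (G \<theta> + \<sigma> *\<^sub>R \<xi>))" if "G \<in> cyclic_shifts" for G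
  proof (rule Bochner_Integration.integrable_bound[OF g])
    show "AE \<xi> in std_gaussian. norm (f (G \<theta> + \<sigma> *\<^sub>R \<xi>)) \<le> norm (g \<xi>)"
      using bound[OF that] by (intro AE_I2) (metis abs_ge_self order_trans real_norm_def)
  qed auto
  show "integrable std_gaussian (\<lambda>\<xi>. f (\<sigma> *\<^sub>R \<xi>) * likelihood_ratio \<sigma> \<theta> \<xi>)"
    by (rule likelihood_ratio_integral(1)[OF f \<sigma> int])
  have "(\<integral>\<xi>. f (\<sigma> *\<^sub>R \<xi>) * likelihood_ratio \<sigma> \<theta> \<xi> \<partial>std_gaussian) =
      (\<Sum>G\<in>cyclic_shifts. \<integral>\<xi>. f (G \<theta> + \<sigma> *\<^sub>R \<xi>) \<partial>std_gaussian) / ?N"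
    by (rule likelihood_ratio_integral(2)[OF f \<sigma> int])
  also have "\<dots> \<le> (\<Sum>G\<in>(cyclic_shifts :: ('l signal \<Rightarrow> _) set). \<integral>\<xi>. g \<xi> \<partial>std_gaussian) / ?N"
  proof (intro divide_right_mono sum_mono integral_mono int g)
    fix G :: "'l signal \<Rightarrow> 'l signal" and \<xi> :: "'l signal" assume "G \<in> cyclic_shifts"
    from bound[OF this, of \<xi>] show "f (G \<theta> + \<sigma> *\<^sub>R \<xi>) \<le> g \<xi>" by simp
  qed auto
  also have "\<dots> = (\<integral>\<xi>. g \<xi> \<partial>std_gaussian)" by simp
  finally show "(\<integral>\<xi>. f (\<sigma> *\<^sub>R \<xi>) * likelihood_ratio \<sigma> \<theta> \<xi> \<partial>std_gaussian) \<le> (\<integral>\<xi>. g \<xi> \<partial>std_gaussian)" .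
qed

lemma integrable_likelihood_ratio: "0 < \<sigma> \<Longrightarrow> integrable std_gaussian (likelihood_ratio \<sigma> \<theta>)"
  and integral_likelihood_ratio: "0 < \<sigma> \<Longrightarrow> (\<integral>\<xi>. likelihood_ratio \<sigma> \<theta> \<xi> \<partial>std_gaussian) = 1"
  using likelihood_ratio_integral[of "\<lambda>_. 1" \<sigma> \<theta>] std_gaussian.prob_space by simp_all

section \<open>Moments under the mixture law\<close>

lemma power_le_fact_mult_exp:
  fixes x :: real
  assumes "0 \<le> x"
  shows "x ^ n \<le> fact n * exp x"
proof -
  \<comment> \<open>A single term of the exponential series is at most its sum.\<close>
  have "(\<Sum>k\<in>{n}. inverse (fact k) *\<^sub>R x ^ k) \<le> exp x"
    unfolding exp_def using assms by (intro sum_le_suminf summable_exp_generic) auto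
  thus ?thesis by (simp add: field_simps)
qed

lemma abs_shift_monomial_le:
  fixes x :: "'l::finite signal"
  assumes "card J \<le> 3"
  shows "\<bar>shift_monomial J x\<bar> \<le> CARD('l) * (1 + norm x) ^ 3"
proof -
  have "\<bar>\<Prod>k\<in>(\<lambda>j. j + l) ` J. x $ k\<bar> \<le> (1 + norm x) ^ 3" for l
  proof -
    have "\<bar>\<Prod>k\<in>(\<lambda>j. j + l) ` J. x $ k\<bar> = (\<Prod>k\<in>(\<lambda>j. j + l) ` J. \<bar>x $ k\<bar>)"
      by (simp add: abs_prod)
    also have "\<dots> \<le> (\<Prod>k\<in>(\<lambda>j. j + l) ` J. 1 + norm x)"
    proof (intro prod_mono conjI)
      fix k show "\<bar>x $ k\<bar> \<le> 1 + norm x" using component_le_norm_cart[of x k] by simp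
    qed simp
    also have "\<dots> = (1 + norm x) ^ card J" by (simp add: card_image)
    \<comment> \<open>The base is at least 1, so sets with fewer than three elements are covered
      too.\<close>
    also have "\<dots> \<le> (1 + norm x) ^ 3" using assms by (intro power_increasing) auto
    finally show ?thesis .
  qed
  hence "\<bar>shift_monomial J x\<bar> \<le> (\<Sum>l\<in>(UNIV :: 'l mod_ring set). (1 + norm x) ^ 3)"
    unfolding shift_monomial_def by (intro order_trans[OF sum_abs] sum_mono)
  thus ?thesis by simp
qed

lemma measurable_shift_monomial [measurable]: "shift_monomial J \<in> borel_measurable borel"
  unfolding shift_monomial_def by measurable

text \<open>Noise leaves the monomial at \<open>G \<theta>\<close> unbiased, and shift invariance
  removes the average over \<open>G\<close>.\<close>

lemma shift_monomial_mean:
  fixes \<theta> :: "'l::finite signal"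
  assumes \<sigma>: "0 < \<sigma>"
  shows "integrable std_gaussian (\<lambda>\<xi>. shift_monomial J (\<sigma> *\<^sub>R \<xi>) * likelihood_ratio \<sigma> \<theta> \<xi>)"
    and "(\<integral>\<xi>. shift_monomial J (\<sigma> *\<^sub>R \<xi>) * likelihood_ratio \<sigma> \<theta> \<xi> \<partial>std_gaussian) = shift_monomial J \<theta>"
proof -
  have int: "integrable std_gaussian (\<lambda>\<xi>. shift_monomial J (y + \<sigma> *\<^sub>R \<xi>))"
    and mean: "(\<integral>\<xi>. shift_monomial J (y + \<sigma> *\<^sub>R \<xi>) \<partial>std_gaussian) = shift_monomial J y" for y :: "'l signal"
  proof -
    show "integrable std_gaussian (\<lambda>\<xi>. shift_monomial J (y + \<sigma> *\<^sub>R \<xi>))"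
      unfolding shift_monomial_def by (intro Bochner_Integration.integrable_sum std_gaussian_mean_prod)
    show "(\<integral>\<xi>. shift_monomial J (y + \<sigma> *\<^sub>R \<xi>) \<partial>std_gaussian) = shift_monomial J y"
      unfolding shift_monomial_def
      by (subst Bochner_Integration.integral_sum) (auto intro: std_gaussian_mean_prod(1) simp only: std_gaussian_mean_prod(2))
  qed
  show "integrable std_gaussian (\<lambda>\<xi>. shift_monomial J (\<sigma> *\<^sub>R \<xi>) * likelihood_ratio \<sigma> \<theta> \<xi>)"
    by (rule likelihood_ratio_integral[OF _ \<sigma> int]) simp
  show "(\<integral>\<xi>. shift_monomial J (\<sigma> *\<^sub>R \<xi>) * likelihood_ratio \<sigma> \<theta> \<xi> \<partial>std_gaussian) = shift_monomial J \<theta>"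
    by (subst likelihood_ratio_integral(2)[OF _ \<sigma> int]) (simp_all add: mean shift_monomial_cyclic_shift)
qed

text \<open>Squaring the sum over translates gives L squared. The other factors come from bounding a
  sixth power by 6! times an exponential, whose argument has the noise-free part
  \<open>1 / m + 1\<close>.\<close>

definition second_moment_const :: "'l::finite itself \<Rightarrow> real \<Rightarrow> real" where
  "second_moment_const _ m =
     (real CARD('l))\<^sup>2 * fact 6 * exp (1 / m + 1) * (\<integral>\<xi>. exp (norm \<xi>) \<partial>(std_gaussian :: 'l signal measure))"

lemma integral_exp_norm_ge_1: "1 \<le> (\<integral>\<xi>. exp (norm \<xi>) \<partial>std_gaussian)"
proof -
  have "(\<integral>\<xi>. 1 \<partial>(std_gaussian :: 'a signal measure)) \<le> (\<integral>\<xi>. exp (norm \<xi>) \<partial>(std_gaussian :: 'a signal measure))"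
    by (intro integral_mono integrable_exp_norm_std_gaussian) auto
  thus ?thesis using std_gaussian.prob_space[where 'a = 'a] by simp
qed

lemma second_moment_const_pos: "0 < second_moment_const TYPE('l::finite) m"
  using integral_exp_norm_ge_1[where 'a = 'l] by (auto simp: second_moment_const_def intro!: mult_pos_pos)

lemma shift_monomial_second_moment:
  fixes \<theta> :: "'l::finite signal"
  assumes m: "0 < m" "m \<le> \<sigma>" and \<theta>: "norm \<theta> \<le> \<sigma>" and J: "card J \<le> 3"
  shows "integrable std_gaussian (\<lambda>\<xi>. (shift_monomial J (\<sigma> *\<^sub>R \<xi>))\<^sup>2 * likelihood_ratio \<sigma> \<theta> \<xi>)" (is ?int)
    and "(\<integral>\<xi>. (shift_monomial J (\<sigma> *\<^sub>R \<xi>))\<^sup>2 * likelihood_ratio \<sigma> \<theta> \<xi> \<partial>std_gaussian) \<le> second_moment_const TYPE('l) m * \<sigma> ^ 6" (is ?le)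
proof -
  have \<sigma>: "0 < \<sigma>" using m by simp
  let ?A = "(real CARD('l))\<^sup>2 * \<sigma> ^ 6 * (fact 6 * exp (1 / m + 1))"
  let ?g = "\<lambda>\<xi> :: 'l signal. ?A * exp (norm \<xi>)"
  have g: "integrable std_gaussian ?g"
    by (intro integrable_mult_right integrable_exp_norm_std_gaussian)
  have bound: "\<bar>(shift_monomial J (G \<theta> + \<sigma> *\<^sub>R \<xi>))\<^sup>2\<bar> \<le> ?g \<xi>" if "G \<in> cyclic_shifts" for G \<xi>
  proof -
    let ?x = "G \<theta> + \<sigma> *\<^sub>R \<xi>"
    have "1 + norm ?x \<le> 1 + (\<sigma> + \<sigma> * norm \<xi>)"
      using norm_triangle_ineq[of "G \<theta>" "\<sigma> *\<^sub>R \<xi>"] \<theta> \<sigma> norm_cyclic_shift[OF that] by simp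
    \<comment> \<open>The lower bound \<open>m\<close> on \<open>\<sigma>\<close> lets the constant
      1 scale with \<open>\<sigma>\<close>, so that the sixth power is of order
      \<open>\<sigma> ^ 6\<close>.\<close>
    also have "1 \<le> \<sigma> / m" using m by simp
    hence "1 + (\<sigma> + \<sigma> * norm \<xi>) \<le> \<sigma> * (1 / m + 1 + norm \<xi>)" by (simp add: algebra_simps)
    finally have x: "1 + norm ?x \<le> \<sigma> * (1 / m + 1 + norm \<xi>)" .
    have "\<bar>(shift_monomial J ?x)\<^sup>2\<bar> = \<bar>shift_monomial J ?x\<bar>\<^sup>2" by simp
    also have "\<dots> \<le> (CARD('l) * (1 + norm ?x) ^ 3)\<^sup>2"
      by (intro power_mono abs_shift_monomial_le J) auto
    also have "\<dots> = (real CARD('l))\<^sup>2 * (1 + norm ?x) ^ 6" by (simp add: power_mult_distrib flip: power_mult)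
    also have "\<dots> \<le> (real CARD('l))\<^sup>2 * (\<sigma> * (1 / m + 1 + norm \<xi>)) ^ 6"
      using x by (intro mult_left_mono power_mono) auto
    also have "\<dots> = (real CARD('l))\<^sup>2 * \<sigma> ^ 6 * (1 / m + 1 + norm \<xi>) ^ 6" by (simp add: power_mult_distrib)
    also have "\<dots> \<le> (real CARD('l))\<^sup>2 * \<sigma> ^ 6 * (fact 6 * exp (1 / m + 1 + norm \<xi>))"
      using m \<sigma> by (intro mult_left_mono power_le_fact_mult_exp) auto
    also have "\<dots> = ?g \<xi>" by (simp add: exp_add)
    finally show ?thesis .
  qed
  show ?int by (rule likelihood_ratio_integral_le(1)[OF _ \<sigma> g bound]) auto
  have "(\<integral>\<xi>. (shift_monomial J (\<sigma> *\<^sub>R \<xi>))\<^sup>2 * likelihood_ratio \<sigma> \<theta> \<xi> \<partial>std_gaussian) \<le> (\<integral>\<xi>. ?g \<xi> \<partial>std_gaussian)"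
    by (rule likelihood_ratio_integral_le(2)[OF _ \<sigma> g bound]) auto
  also have "\<dots> = second_moment_const TYPE('l) m * \<sigma> ^ 6"
    by (simp add: second_moment_const_def integrable_exp_norm_std_gaussian)
  finally show ?le .
qed

section \<open>The squared Hellinger distance, without the factor 1/2\<close>

definition hellinger :: "real \<Rightarrow> 'l::finite signal \<Rightarrow> 'l signal \<Rightarrow> real" where
  "hellinger \<sigma> \<theta> \<phi> =
     (\<integral>\<xi>. (sqrt (likelihood_ratio \<sigma> \<theta> \<xi>) - sqrt (likelihood_ratio \<sigma> \<phi> \<xi>))\<^sup>2 \<partial>std_gaussian)"

lemma hellinger_nonneg: "0 \<le> hellinger \<sigma> \<theta> \<phi>"
  unfolding hellinger_def by (rule Bochner_Integration.integral_nonneg) simp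

text \<open>The geometric mean of the densities is dominated by their arithmetic mean.\<close>

lemma integrable_affinity:
  assumes "0 < \<sigma>"
  shows "integrable std_gaussian (\<lambda>\<xi>. sqrt (likelihood_ratio \<sigma> \<theta> \<xi> * likelihood_ratio \<sigma> \<phi> \<xi>))"
proof (rule Bochner_Integration.integrable_bound)
  show "integrable std_gaussian (\<lambda>\<xi>. (likelihood_ratio \<sigma> \<theta> \<xi> + likelihood_ratio \<sigma> \<phi> \<xi>) / 2)"
    by (auto simp: integrable_likelihood_ratio[OF assms])
  show "AE \<xi> in std_gaussian. norm (sqrt (likelihood_ratio \<sigma> \<theta> \<xi> * likelihood_ratio \<sigma> \<phi> \<xi>))
      \<le> norm ((likelihood_ratio \<sigma> \<theta> \<xi> + likelihood_ratio \<sigma> \<phi> \<xi>) / 2)"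
  proof (rule AE_I2)
    fix \<xi>
    have "0 \<le> likelihood_ratio \<sigma> \<theta> \<xi>" "0 \<le> likelihood_ratio \<sigma> \<phi> \<xi>"
      using likelihood_ratio_pos less_imp_le by blast+
    thus "norm (sqrt (likelihood_ratio \<sigma> \<theta> \<xi> * likelihood_ratio \<sigma> \<phi> \<xi>))
      \<le> norm ((likelihood_ratio \<sigma> \<theta> \<xi> + likelihood_ratio \<sigma> \<phi> \<xi>) / 2)"
      using arith_geo_mean_sqrt[of "likelihood_ratio \<sigma> \<theta> \<xi>" "likelihood_ratio \<sigma> \<phi> \<xi>"] by simp
  qed
qed auto

lemma hellinger_expand:
  "(sqrt (likelihood_ratio \<sigma> \<theta> \<xi>) - sqrt (likelihood_ratio \<sigma> \<phi> \<xi>))\<^sup>2 =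
     likelihood_ratio \<sigma> \<theta> \<xi> + likelihood_ratio \<sigma> \<phi> \<xi> - 2 * sqrt (likelihood_ratio \<sigma> \<theta> \<xi> * likelihood_ratio \<sigma> \<phi> \<xi>)"
  using likelihood_ratio_pos[of \<sigma> \<theta> \<xi>] likelihood_ratio_pos[of \<sigma> \<phi> \<xi>]
  by (simp add: power2_diff real_sqrt_mult)

lemma integrable_hellinger:
  assumes "0 < \<sigma>"
  shows "integrable std_gaussian (\<lambda>\<xi>. (sqrt (likelihood_ratio \<sigma> \<theta> \<xi>) - sqrt (likelihood_ratio \<sigma> \<phi> \<xi>))\<^sup>2)"
  unfolding hellinger_expand using integrable_affinity[OF assms] integrable_likelihood_ratio[OF assms]
  by (intro Bochner_Integration.integrable_diff Bochner_Integration.integrable_add integrable_mult_right)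

text \<open>Both likelihood ratios integrate to one, so expanding the square leaves only the
  affinity, which is the Chernoff moment of exponent 1/2.\<close>

lemma integral_affinity:
  assumes "0 < \<sigma>"
  shows "(\<integral>\<xi>. sqrt (likelihood_ratio \<sigma> \<theta> \<xi> * likelihood_ratio \<sigma> \<phi> \<xi>) \<partial>std_gaussian) = 1 - hellinger \<sigma> \<theta> \<phi> / 2"
  unfolding hellinger_def hellinger_expand
  by (simp add: integrable_affinity[OF assms] integrable_likelihood_ratio[OF assms] integral_likelihood_ratio[OF assms]
        diff_divide_distrib)

text \<open>Cauchy--Schwarz, in the form of the arithmetic-geometric mean inequality with the
  optimal weight \<open>t\<close>.\<close>

lemma shift_monomial_diff_le_hellinger:
  fixes \<theta> \<phi> :: "'l::finite signal"
  assumes m: "0 < m" "m \<le> \<sigma>" and \<theta>: "norm \<theta> \<le> \<sigma>" and \<phi>: "norm \<phi> \<le> \<sigma>" and J: "card J \<le> 3"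
  shows "(shift_monomial J \<theta> - shift_monomial J \<phi>)\<^sup>2 \<le> 4 * second_moment_const TYPE('l) m * \<sigma> ^ 6 * hellinger \<sigma> \<theta> \<phi>"
proof (cases "shift_monomial J \<theta> = shift_monomial J \<phi>")
  case True
  thus ?thesis using hellinger_nonneg[of \<sigma> \<theta> \<phi>] second_moment_const_pos[of m, where 'l='l] m
    by (simp add: mult_nonneg_nonneg)
next
  case False
  have \<sigma>: "0 < \<sigma>" using m by simp
  \<comment> \<open>The factor 4 makes the two second moments add up to at most
    \<open>W / 2\<close>.\<close>
  define W where "W = 4 * second_moment_const TYPE('l) m * \<sigma> ^ 6"
  define D where "D = \<bar>shift_monomial J \<theta> - shift_monomial J \<phi>\<bar>"
  \<comment> \<open>This weight turns the bound on the second-moment term into \<open>D / 2\<close>,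
    half of the left-hand side.\<close>
  define t where "t = W / D"
  have W: "W > 0" unfolding W_def using second_moment_const_pos[of m, where 'l='l] \<sigma> by simp
  have D: "D > 0" unfolding D_def using False by simp
  have t: "t > 0" unfolding t_def using W D by simp
  let ?g = "\<lambda>\<xi>. shift_monomial J (\<sigma> *\<^sub>R \<xi>)"
  let ?p = "likelihood_ratio \<sigma> \<theta>" and ?q = "likelihood_ratio \<sigma> \<phi>"
  note mean\<theta> = shift_monomial_mean[OF \<sigma>, of J \<theta>] and mean\<phi> = shift_monomial_mean[OF \<sigma>, of J \<phi>]
  note sq\<theta> = shift_monomial_second_moment[OF m \<theta> J] and sq\<phi> = shift_monomial_second_moment[OF m \<phi> J]
  have pointwise: "\<bar>?g \<xi> * ?p \<xi> - ?g \<xi> * ?q \<xi>\<bar>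
    \<le> t / 2 * (sqrt (?p \<xi>) - sqrt (?q \<xi>))\<^sup>2 + 1 / t * ((?g \<xi>)\<^sup>2 * ?p \<xi> + (?g \<xi>)\<^sup>2 * ?q \<xi>)" for \<xi>
  proof -
    define a b g where "a = sqrt (?p \<xi>)" and "b = sqrt (?q \<xi>)" and "g = ?g \<xi>"
    have ab: "?p \<xi> = a\<^sup>2" "?q \<xi> = b\<^sup>2"
      using likelihood_ratio_pos[of \<sigma> \<theta> \<xi>] likelihood_ratio_pos[of \<sigma> \<phi> \<xi>] by (simp_all add: a_def b_def)
    \<comment> \<open>The difference of the densities factors as \<open>(a - b) * (a + b)\<close>.
      The first factor carries the weight \<open>t\<close>, and the square of the second is at most
      \<open>2 * (a^2 + b^2)\<close>.\<close>
    have "2 * (\<bar>a - b\<bar> * t) * \<bar>g * (a + b)\<bar> \<le> (\<bar>a - b\<bar> * t)\<^sup>2 + \<bar>g * (a + b)\<bar>\<^sup>2"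
      by (rule sum_squares_bound)
    also have "\<dots> = t\<^sup>2 * (a - b)\<^sup>2 + g\<^sup>2 * (a + b)\<^sup>2" by (simp add: power_mult_distrib)
    also have "g\<^sup>2 * (a + b)\<^sup>2 \<le> g\<^sup>2 * (2 * (a\<^sup>2 + b\<^sup>2))"
      using sum_squares_bound[of a b] by (intro mult_left_mono) (auto simp: power2_sum)
    finally have *: "2 * t * (\<bar>a - b\<bar> * \<bar>g * (a + b)\<bar>) \<le> 2 * t * (t / 2 * (a - b)\<^sup>2 + 1 / t * (g\<^sup>2 * a\<^sup>2 + g\<^sup>2 * b\<^sup>2))"
      using t by (simp add: algebra_simps power2_eq_square)
    have "\<bar>g * a\<^sup>2 - g * b\<^sup>2\<bar> = \<bar>a - b\<bar> * \<bar>g * (a + b)\<bar>"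
      unfolding abs_mult[symmetric] by (simp add: algebra_simps power2_eq_square)
    also have "\<dots> \<le> t / 2 * (a - b)\<^sup>2 + 1 / t * (g\<^sup>2 * a\<^sup>2 + g\<^sup>2 * b\<^sup>2)"
      using * t by (subst (asm) mult_le_cancel_left_pos) auto
    finally show ?thesis unfolding ab[symmetric] unfolding a_def b_def g_def .
  qed
  have "D = \<bar>\<integral>\<xi>. ?g \<xi> * ?p \<xi> - ?g \<xi> * ?q \<xi> \<partial>std_gaussian\<bar>"
    unfolding D_def using mean\<theta> mean\<phi> by simp
  also have "\<dots> \<le> (\<integral>\<xi>. \<bar>?g \<xi> * ?p \<xi> - ?g \<xi> * ?q \<xi>\<bar> \<partial>std_gaussian)" by (rule integral_abs_bound)
  also have "\<dots> \<le> (\<integral>\<xi>. t / 2 * (sqrt (?p \<xi>) - sqrt (?q \<xi>))\<^sup>2 + 1 / t * ((?g \<xi>)\<^sup>2 * ?p \<xi> + (?g \<xi>)\<^sup>2 * ?q \<xi>) \<partial>std_gaussian)"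
    by (intro integral_mono pointwise integrable_abs Bochner_Integration.integrable_diff mean\<theta>(1) mean\<phi>(1)
        Bochner_Integration.integrable_add integrable_mult_right integrable_hellinger[OF \<sigma>] sq\<theta>(1) sq\<phi>(1))
  also have "\<dots> = t / 2 * hellinger \<sigma> \<theta> \<phi> + 1 / t * ((\<integral>\<xi>. (?g \<xi>)\<^sup>2 * ?p \<xi> \<partial>std_gaussian) + (\<integral>\<xi>. (?g \<xi>)\<^sup>2 * ?q \<xi> \<partial>std_gaussian))"
  proof -
    have i1: "integrable std_gaussian (\<lambda>\<xi>. t / 2 * (sqrt (?p \<xi>) - sqrt (?q \<xi>))\<^sup>2)"
      by (intro integrable_mult_right integrable_hellinger[OF \<sigma>])
    have i2: "integrable std_gaussian (\<lambda>\<xi>. 1 / t * ((?g \<xi>)\<^sup>2 * ?p \<xi> + (?g \<xi>)\<^sup>2 * ?q \<xi>))"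
      by (intro integrable_mult_right Bochner_Integration.integrable_add sq\<theta>(1) sq\<phi>(1))
    show ?thesis
      unfolding Bochner_Integration.integral_add[OF i1 i2] integral_mult_right_zero
        Bochner_Integration.integral_add[OF sq\<theta>(1) sq\<phi>(1)] hellinger_def ..
  qed
  also have "\<dots> \<le> t / 2 * hellinger \<sigma> \<theta> \<phi> + 1 / t * (W / 2)"
    using sq\<theta>(2) sq\<phi>(2) t by (intro add_left_mono mult_left_mono) (auto simp: W_def)
  also have "\<dots> = W * hellinger \<sigma> \<theta> \<phi> / (2 * D) + D / 2"
    unfolding t_def using W D by (simp add: field_simps)
  finally have "D / 2 \<le> W * hellinger \<sigma> \<theta> \<phi> / (2 * D)" by simp
  hence "D\<^sup>2 \<le> W * hellinger \<sigma> \<theta> \<phi>" using D by (simp add: field_simps power2_eq_square)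
  thus ?thesis by (simp add: D_def W_def)
qed

text \<open>The root \<open>?D\<close> bounds the difference of every monomial of order two or
  three, so it can serve as \<open>\<Delta>\<close> in the recovery estimate. Squaring gives the
  claim.\<close>

lemma orbit_dist_le_hellinger:
  assumes m: "0 < m" and M: "0 < M"
  obtains c where "c > 0" and
    "\<And>\<sigma> \<theta> \<phi>. m \<le> \<sigma> \<Longrightarrow> norm \<theta> \<le> \<sigma> \<Longrightarrow> norm \<phi> \<le> \<sigma> \<Longrightarrow>
       bounded_collision_free m M \<theta> \<Longrightarrow> bounded_collision_free m M (\<phi> :: 'l::finite signal) \<Longrightarrow>
       c * (orbit_dist \<phi> \<theta>)\<^sup>2 / \<sigma> ^ 6 \<le> hellinger \<sigma> \<theta> \<phi>"
proof -
  obtain K where K: "K > 0" and mom: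
    "\<And>\<theta> \<phi> \<Delta>. bounded_collision_free m M \<theta> \<Longrightarrow> bounded_collision_free m M (\<phi> :: 'l signal) \<Longrightarrow> 0 \<le> \<Delta> \<Longrightarrow>
      (\<And>J. 2 \<le> card J \<Longrightarrow> card J \<le> 3 \<Longrightarrow> \<bar>shift_monomial J \<theta> - shift_monomial J \<phi>\<bar> \<le> \<Delta>) \<Longrightarrow>
      orbit_dist \<phi> \<theta> \<le> K * \<Delta>"
    using orbit_dist_le_moments_global[OF m M] by metis
  let ?V = "second_moment_const TYPE('l) m"
  have V: "?V > 0" by (rule second_moment_const_pos)
  show ?thesis
  proof
    show "1 / (K\<^sup>2 * (4 * ?V)) > 0" using K V by simp
    fix \<sigma> :: real and \<theta> \<phi> :: "'l signal"
    assume \<sigma>: "m \<le> \<sigma>" and n: "norm \<theta> \<le> \<sigma>" "norm \<phi> \<le> \<sigma>"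
      and b: "bounded_collision_free m M \<theta>" "bounded_collision_free m M \<phi>"
    let ?D = "sqrt (4 * ?V * \<sigma> ^ 6 * hellinger \<sigma> \<theta> \<phi>)"
    have nonneg: "4 * ?V * \<sigma> ^ 6 * hellinger \<sigma> \<theta> \<phi> \<ge> 0"
      using V m \<sigma> hellinger_nonneg[of \<sigma> \<theta> \<phi>] by simp
    have "orbit_dist \<phi> \<theta> \<le> K * ?D"
    proof (rule mom[OF b])
      fix J :: "'l mod_ring set" assume "card J \<le> 3"
      from shift_monomial_diff_le_hellinger[OF m \<sigma> n this]
      show "\<bar>shift_monomial J \<theta> - shift_monomial J \<phi>\<bar> \<le> ?D" by (metis real_sqrt_abs real_sqrt_le_mono)
    qed (use nonneg in simp)
    hence "(orbit_dist \<phi> \<theta>)\<^sup>2 \<le> (K * ?D)\<^sup>2" by (intro power_mono orbit_dist_nonneg)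
    also have "\<dots> = K\<^sup>2 * (4 * ?V) * (\<sigma> ^ 6 * hellinger \<sigma> \<theta> \<phi>)"
      using nonneg by (simp add: power_mult_distrib)
    finally show "1 / (K\<^sup>2 * (4 * ?V)) * (orbit_dist \<phi> \<theta>)\<^sup>2 / \<sigma> ^ 6 \<le> hellinger \<sigma> \<theta> \<phi>"
      using K V m \<sigma> by (simp add: field_simps)
  qed
qed


section \<open>Chernoff bound and discretization\<close>

lemma pmf_expectation_cyclic_shifts:
  "measure_pmf.expectation (pmf_of_set cyclic_shifts) f =
     (\<Sum>G\<in>(cyclic_shifts :: ('l::finite signal \<Rightarrow> _) set). f G) / real (card (cyclic_shifts :: ('l signal \<Rightarrow> _) set))"
  by (subst integral_pmf_of_set) auto

text \<open>Expanding the squared norm separates a factor that involves only \<open>x\<close> and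
  \<open>\<sigma>\<close>. What remains is the likelihood ratio at the rescaled observation.\<close>

lemma mixture_eq_likelihood_ratio:
  fixes x \<phi> :: "'l::finite signal"
  assumes \<sigma>: "0 < \<sigma>"
  shows "measure_pmf.expectation (pmf_of_set cyclic_shifts) (\<lambda>G. exp (- (1 / (2 * \<sigma>\<^sup>2)) * (norm (x - G \<phi>))\<^sup>2)) =
    exp (- (norm x)\<^sup>2 / (2 * \<sigma>\<^sup>2)) * likelihood_ratio \<sigma> \<phi> ((1 / \<sigma>) *\<^sub>R x)"
proof -
  have "exp (- (1 / (2 * \<sigma>\<^sup>2)) * (norm (x - y))\<^sup>2) =
      exp (- (norm x)\<^sup>2 / (2 * \<sigma>\<^sup>2)) * translate_density ((1 / \<sigma>) *\<^sub>R y) ((1 / \<sigma>) *\<^sub>R x)" for y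
  proof -
    have 1: "(norm (x - y))\<^sup>2 = (norm x)\<^sup>2 + (norm y)\<^sup>2 - 2 * (y \<bullet> x)"
      unfolding power2_norm_eq_inner by (simp add: inner_diff_left inner_diff_right inner_commute)
    have 2: "(norm ((1 / \<sigma>) *\<^sub>R y))\<^sup>2 = (norm y)\<^sup>2 / \<sigma>\<^sup>2" using \<sigma> by (simp add: power_divide)
    have 3: "((1 / \<sigma>) *\<^sub>R y) \<bullet> ((1 / \<sigma>) *\<^sub>R x) = (y \<bullet> x) / \<sigma>\<^sup>2" by (simp add: power2_eq_square)
    have "- (1 / (2 * \<sigma>\<^sup>2)) * (norm (x - y))\<^sup>2 =
      - (norm x)\<^sup>2 / (2 * \<sigma>\<^sup>2) + (((1 / \<sigma>) *\<^sub>R y) \<bullet> ((1 / \<sigma>) *\<^sub>R x) - (norm ((1 / \<sigma>) *\<^sub>R y))\<^sup>2 / 2)"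
      unfolding 1 2 3 using \<sigma> by (simp add: field_simps)
    thus ?thesis by (simp only: translate_density_def exp_add)
  qed
  thus ?thesis
    by (simp only: pmf_expectation_cyclic_shifts likelihood_ratio_def sum_distrib_left times_divide_eq_right)
qed

text \<open>The first sum is the same for all \<open>\<phi>\<close>, so comparing signals by
  likelihood amounts to comparing the second.\<close>

lemma log_likelihood_eq:
  assumes \<sigma>: "0 < \<sigma>"
  shows "log_likelihood \<sigma> n X \<phi> =
    (\<Sum>i<n. - (norm (X i))\<^sup>2 / (2 * \<sigma>\<^sup>2)) + (\<Sum>i<n. ln (likelihood_ratio \<sigma> \<phi> ((1 / \<sigma>) *\<^sub>R X i)))"
  unfolding log_likelihood_def mixture_eq_likelihood_ratio[OF \<sigma>]
  by (simp add: ln_mult likelihood_ratio_pos less_imp_neq[OF likelihood_ratio_pos, symmetric] flip: sum.distrib)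

text \<open>In the exponent of each component the linear term grows by at most
  \<open>u * norm \<xi>\<close> and the quadratic one by at most \<open>u\<close>. The resulting
  factor is common to all shifts and passes through their average.\<close>

lemma likelihood_ratio_lipschitz:
  fixes \<phi> \<psi> :: "'l::finite signal"
  assumes \<sigma>: "0 < \<sigma>" and n: "norm \<phi> \<le> \<sigma>" "norm \<psi> \<le> \<sigma>" and u: "norm (\<phi> - \<psi>) \<le> u * \<sigma>"
  shows "ln (likelihood_ratio \<sigma> \<phi> \<xi>) \<le> ln (likelihood_ratio \<sigma> \<psi> \<xi>) + u * (norm \<xi> + 1)"
proof -
  let ?e = "exp (u * (norm \<xi> + 1))"
  have summand: "translate_density ((1 / \<sigma>) *\<^sub>R G \<phi>) \<xi> \<le> translate_density ((1 / \<sigma>) *\<^sub>R G \<psi>) \<xi> * ?e"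
    if G: "G \<in> cyclic_shifts" for G
  proof -
    have "((1 / \<sigma>) *\<^sub>R G \<phi>) \<bullet> \<xi> - ((1 / \<sigma>) *\<^sub>R G \<psi>) \<bullet> \<xi> = (1 / \<sigma>) * (G (\<phi> - \<psi>) \<bullet> \<xi>)"
      by (simp add: cyclic_shift_diff[OF G] inner_diff_left diff_divide_distrib)
    also have "\<dots> \<le> (1 / \<sigma>) * (u * \<sigma> * norm \<xi>)"
    proof (rule mult_left_mono)
      have "G (\<phi> - \<psi>) \<bullet> \<xi> \<le> norm (G (\<phi> - \<psi>)) * norm \<xi>" by (rule norm_cauchy_schwarz)
      also have "\<dots> \<le> u * \<sigma> * norm \<xi>"
        using u norm_cyclic_shift[OF G] by (intro mult_right_mono) auto
      finally show "G (\<phi> - \<psi>) \<bullet> \<xi> \<le> u * \<sigma> * norm \<xi>" .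
    qed (use \<sigma> in simp)
    also have "\<dots> = u * norm \<xi>" using \<sigma> by simp
    finally have 1: "((1 / \<sigma>) *\<^sub>R G \<phi>) \<bullet> \<xi> - ((1 / \<sigma>) *\<^sub>R G \<psi>) \<bullet> \<xi> \<le> u * norm \<xi>" .
    have "(norm \<psi>)\<^sup>2 - (norm \<phi>)\<^sup>2 = (norm \<psi> - norm \<phi>) * (norm \<psi> + norm \<phi>)"
      by (simp add: power2_eq_square algebra_simps)
    also have "\<dots> \<le> (u * \<sigma>) * (norm \<psi> + norm \<phi>)"
      using u norm_triangle_ineq2[of \<psi> \<phi>] by (intro mult_right_mono) (auto simp: norm_minus_commute)
    also have "\<dots> \<le> (u * \<sigma>) * (\<sigma> + \<sigma>)"
      using u n norm_ge_zero[of "\<phi> - \<psi>"] by (intro mult_left_mono add_mono) linarith+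
    finally have "((norm \<psi>)\<^sup>2 - (norm \<phi>)\<^sup>2) / (2 * \<sigma>\<^sup>2) \<le> u"
      using \<sigma> by (simp add: field_simps power2_eq_square)
    hence 2: "(norm ((1 / \<sigma>) *\<^sub>R G \<psi>))\<^sup>2 / 2 - (norm ((1 / \<sigma>) *\<^sub>R G \<phi>))\<^sup>2 / 2 \<le> u"
      using \<sigma> by (simp add: norm_cyclic_shift[OF G] power_divide diff_divide_distrib mult.commute)
    show ?thesis unfolding translate_density_def exp_add[symmetric] exp_le_cancel_iff
      using 1 2 unfolding distrib_left mult_1_right by linarith
  qed
  have "likelihood_ratio \<sigma> \<phi> \<xi> \<le> likelihood_ratio \<sigma> \<psi> \<xi> * ?e"
    unfolding likelihood_ratio_def times_divide_eq_left sum_distrib_right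
    by (intro divide_right_mono sum_mono summand) auto
  hence "ln (likelihood_ratio \<sigma> \<phi> \<xi>) \<le> ln (likelihood_ratio \<sigma> \<psi> \<xi> * ?e)"
    using likelihood_ratio_pos[of \<sigma> \<phi> \<xi>] likelihood_ratio_pos[of \<sigma> \<psi> \<xi>] by (subst ln_le_cancel_iff) auto
  also have "\<dots> = ln (likelihood_ratio \<sigma> \<psi> \<xi>) + u * (norm \<xi> + 1)"
    using likelihood_ratio_pos[of \<sigma> \<psi> \<xi>] by (subst ln_mult) auto
  finally show ?thesis .
qed

text \<open>The square root of the likelihood ratio of \<open>\<phi>\<close> and \<open>\<theta>\<close>, inflated to dominate those of
  all signals within distance \<open>u \<sigma>\<close> of \<open>\<phi>\<close>.\<close>

definition chernoff_factor :: "real \<Rightarrow> real \<Rightarrow> 'l::finite signal \<Rightarrow> 'l signal \<Rightarrow> 'l signal \<Rightarrow> real" where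
  "chernoff_factor \<sigma> u \<theta> \<phi> x =
     exp ((ln (likelihood_ratio \<sigma> \<phi> ((1 / \<sigma>) *\<^sub>R x)) - ln (likelihood_ratio \<sigma> \<theta> ((1 / \<sigma>) *\<^sub>R x))
           + u * (norm ((1 / \<sigma>) *\<^sub>R x) + 1)) / 2)"

lemma measurable_chernoff_factor [measurable]: "chernoff_factor \<sigma> u \<theta> \<phi> \<in> borel_measurable borel"
proof -
  have [measurable]: "(\<lambda>x. likelihood_ratio \<sigma> \<psi> ((1 / \<sigma>) *\<^sub>R x)) \<in> borel_measurable borel" for \<psi> :: "'a signal"
    by (rule measurable_compose[OF _ measurable_likelihood_ratio]) simp
  show ?thesis unfolding chernoff_factor_def by measurable
qed

text \<open>The factor \<open>exp 2\<close> collects the 1 added to the norm in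
  \<open>chernoff_factor\<close> and the norm of the rescaled signal, which is at most 1.\<close>

definition tilt_const :: "'l::finite itself \<Rightarrow> real" where
  "tilt_const _ = exp 2 * (\<integral>\<xi>. exp (norm \<xi>) \<partial>(std_gaussian :: 'l signal measure))"

text \<open>The bound is linear in \<open>u\<close>, so a small inflation costs little in the mean.
  It follows from \<open>exp x - 1 \<le> x * exp x\<close> and \<open>s \<le> exp s\<close>.\<close>

lemma exp_mult_diff_1_le:
  fixes u s :: real
  assumes "0 \<le> u" "u \<le> 1" "0 \<le> s"
  shows "exp (u * s) - 1 \<le> u * exp (2 * s)"
proof -
  have "1 - u * s \<le> exp (- (u * s))" using exp_ge_add_one_self[of "- (u * s)"] by simp
  hence "(1 - u * s) * exp (u * s) \<le> exp (- (u * s)) * exp (u * s)" by (rule mult_right_mono) simp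
  hence "exp (u * s) - 1 \<le> u * (s * exp (u * s))" by (simp add: exp_minus algebra_simps)
  also have "\<dots> \<le> u * (exp s * exp s)"
  proof (intro mult_left_mono mult_mono)
    show "s \<le> exp s" using exp_ge_add_one_self[of s] by linarith
    show "exp (u * s) \<le> exp s" using mult_right_mono[of u 1 s] assms by simp
  qed (use assms in auto)
  finally show ?thesis by (simp flip: exp_add)
qed

text \<open>Multiplied by the density of \<open>\<theta>\<close>, the factor becomes the geometric
  mean of the two densities times \<open>1 + h\<close>. The geometric mean integrates to the
  affinity. In the product with \<open>h\<close> it is replaced by the arithmetic mean, which leaves
  the means of \<open>h\<close> under the two laws, both of order \<open>u\<close>.\<close>

lemma nn_integral_chernoff_factor:
  fixes \<theta> \<phi> :: "'l::finite signal"
  assumes \<sigma>: "0 < \<sigma>" and n: "norm \<theta> \<le> \<sigma>" "norm \<phi> \<le> \<sigma>" and u: "0 \<le> u" "u \<le> 1"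
  shows "(\<integral>\<^sup>+x. ennreal (chernoff_factor \<sigma> u \<theta> \<phi> x) \<partial>sample_law \<sigma> \<theta>)
     \<le> ennreal (1 - hellinger \<sigma> \<theta> \<phi> / 2 + u * tilt_const TYPE('l))"
proof -
  let ?p = "likelihood_ratio \<sigma> \<theta>" and ?q = "likelihood_ratio \<sigma> \<phi>"
  define h where "h x = exp (u * ((norm ((1 / \<sigma>) *\<^sub>R x) + 1) / 2)) - 1" for x :: "'l signal"
  have h [measurable]: "h \<in> borel_measurable borel" unfolding h_def by measurable
  have h_nonneg: "0 \<le> h x" for x unfolding h_def using u by simp
  let ?g = "\<lambda>\<xi>::'l signal. u * (exp 2 * exp (norm \<xi>))"
  have g: "integrable std_gaussian ?g" by (intro integrable_mult_right integrable_exp_norm_std_gaussian)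
  have bound: "\<bar>h (G \<psi> + \<sigma> *\<^sub>R \<xi>)\<bar> \<le> ?g \<xi>" if "G \<in> cyclic_shifts" "norm \<psi> \<le> \<sigma>" for G \<psi> \<xi>
  proof -
    have "norm ((1 / \<sigma>) *\<^sub>R (G \<psi> + \<sigma> *\<^sub>R \<xi>)) = norm ((1 / \<sigma>) *\<^sub>R G \<psi> + \<xi>)"
      using \<sigma> by (simp add: scaleR_add_right)
    also have "\<dots> \<le> norm ((1 / \<sigma>) *\<^sub>R G \<psi>) + norm \<xi>" by (rule norm_triangle_ineq)
    also have "\<dots> \<le> 1 + norm \<xi>" using that \<sigma> by (simp add: norm_cyclic_shift)
    finally have w: "norm ((1 / \<sigma>) *\<^sub>R (G \<psi> + \<sigma> *\<^sub>R \<xi>)) \<le> 1 + norm \<xi>" .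
    have "(w + 1) / 2 \<le> (2 + v) / 2" if "w \<le> 1 + v" for w v :: real using that by simp
    note le = this[OF w]
    have "h (G \<psi> + \<sigma> *\<^sub>R \<xi>) \<le> exp (u * ((2 + norm \<xi>) / 2)) - 1"
      unfolding h_def using mult_left_mono[OF le u(1)] by simp
    \<comment> \<open>The doubled argument cancels the halving in the exponent of
      \<open>h\<close>.\<close>
    also have "\<dots> \<le> u * exp (2 * ((2 + norm \<xi>) / 2))" by (rule exp_mult_diff_1_le) (use u in auto)
    also have "2 * ((2 + norm \<xi>) / 2) = 2 + norm \<xi>" by simp
    also have "u * exp (2 + norm \<xi>) = ?g \<xi>" by (simp add: exp_add)
    finally show ?thesis using h_nonneg by simp
  qed
  have int: "integrable std_gaussian (\<lambda>\<xi>. h (\<sigma> *\<^sub>R \<xi>) * likelihood_ratio \<sigma> \<psi> \<xi>)"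
    and le: "(\<integral>\<xi>. h (\<sigma> *\<^sub>R \<xi>) * likelihood_ratio \<sigma> \<psi> \<xi> \<partial>std_gaussian) \<le> u * tilt_const TYPE('l)"
    if "norm \<psi> \<le> \<sigma>" for \<psi>
  proof -
    show "integrable std_gaussian (\<lambda>\<xi>. h (\<sigma> *\<^sub>R \<xi>) * likelihood_ratio \<sigma> \<psi> \<xi>)"
      by (rule likelihood_ratio_integral_le(1)[OF h \<sigma> g bound[OF _ that]])
    have "(\<integral>\<xi>. h (\<sigma> *\<^sub>R \<xi>) * likelihood_ratio \<sigma> \<psi> \<xi> \<partial>std_gaussian) \<le> (\<integral>\<xi>. ?g \<xi> \<partial>std_gaussian)"
      by (rule likelihood_ratio_integral_le(2)[OF h \<sigma> g bound[OF _ that]])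
    thus "(\<integral>\<xi>. h (\<sigma> *\<^sub>R \<xi>) * likelihood_ratio \<sigma> \<psi> \<xi> \<partial>std_gaussian) \<le> u * tilt_const TYPE('l)"
      by (simp add: tilt_const_def)
  qed
  let ?F = "\<lambda>\<xi>. sqrt (?p \<xi> * ?q \<xi>) + (h (\<sigma> *\<^sub>R \<xi>) * ?p \<xi> + h (\<sigma> *\<^sub>R \<xi>) * ?q \<xi>) / 2"
  have intF: "integrable std_gaussian ?F"
    by (intro Bochner_Integration.integrable_add integrable_divide_zero integrable_affinity[OF \<sigma>] int n)
  have F: "chernoff_factor \<sigma> u \<theta> \<phi> (\<sigma> *\<^sub>R \<xi>) * ?p \<xi> \<le> ?F \<xi>" for \<xi>
  proof -
    have pos: "0 < ?p \<xi>" "0 < ?q \<xi>" by (rule likelihood_ratio_pos)+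
    have \<xi>: "(1 / \<sigma>) *\<^sub>R \<sigma> *\<^sub>R \<xi> = \<xi>" using \<sigma> by simp
    have "sqrt (?p \<xi> * ?q \<xi>) = exp (ln (sqrt (?p \<xi> * ?q \<xi>)))" using pos by simp
    also have "ln (sqrt (?p \<xi> * ?q \<xi>)) = (ln (?q \<xi>) - ln (?p \<xi>)) / 2 + ln (?p \<xi>)"
      using pos by (simp add: ln_sqrt ln_mult field_simps)
    finally have s: "sqrt (?p \<xi> * ?q \<xi>) = exp ((ln (?q \<xi>) - ln (?p \<xi>)) / 2) * ?p \<xi>"
      using pos by (simp add: exp_add)
    have "chernoff_factor \<sigma> u \<theta> \<phi> (\<sigma> *\<^sub>R \<xi>) * ?p \<xi> = sqrt (?p \<xi> * ?q \<xi>) * (1 + h (\<sigma> *\<^sub>R \<xi>))"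
      unfolding chernoff_factor_def h_def \<xi> s add_divide_distrib exp_add by simp
    also have "\<dots> = sqrt (?p \<xi> * ?q \<xi>) + sqrt (?p \<xi> * ?q \<xi>) * h (\<sigma> *\<^sub>R \<xi>)" by (simp add: algebra_simps)
    also have "\<dots> \<le> sqrt (?p \<xi> * ?q \<xi>) + (?p \<xi> + ?q \<xi>) / 2 * h (\<sigma> *\<^sub>R \<xi>)"
      using pos by (intro add_left_mono mult_right_mono arith_geo_mean_sqrt h_nonneg) auto
    finally show ?thesis by (simp add: algebra_simps add_divide_distrib)
  qed
  have "(\<integral>\<^sup>+x. ennreal (chernoff_factor \<sigma> u \<theta> \<phi> x) \<partial>sample_law \<sigma> \<theta>) =
    (\<integral>\<^sup>+\<xi>. ennreal (chernoff_factor \<sigma> u \<theta> \<phi> (\<sigma> *\<^sub>R \<xi>)) * ennreal (?p \<xi>) \<partial>std_gaussian)"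
    by (rule nn_integral_sample_law[OF _ \<sigma>]) measurable
  also have "\<dots> \<le> (\<integral>\<^sup>+\<xi>. ennreal (?F \<xi>) \<partial>std_gaussian)"
  proof (rule nn_integral_mono)
    fix \<xi> :: "'l signal"
    have "ennreal (chernoff_factor \<sigma> u \<theta> \<phi> (\<sigma> *\<^sub>R \<xi>)) * ennreal (?p \<xi>) =
        ennreal (chernoff_factor \<sigma> u \<theta> \<phi> (\<sigma> *\<^sub>R \<xi>) * ?p \<xi>)"
      by (rule ennreal_mult[symmetric]) (auto simp: chernoff_factor_def less_imp_le[OF likelihood_ratio_pos])
    also have "\<dots> \<le> ennreal (?F \<xi>)" by (intro ennreal_leI F)
    finally show "ennreal (chernoff_factor \<sigma> u \<theta> \<phi> (\<sigma> *\<^sub>R \<xi>)) * ennreal (?p \<xi>) \<le> ennreal (?F \<xi>)" .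
  qed
  also have "\<dots> = ennreal (\<integral>\<xi>. ?F \<xi> \<partial>std_gaussian)"
  proof (intro nn_integral_eq_integral intF AE_I2)
    fix \<xi> :: "'l signal"
    have "0 \<le> ?p \<xi>" "0 \<le> ?q \<xi>" using likelihood_ratio_pos less_imp_le by blast+
    thus "0 \<le> ?F \<xi>" using h_nonneg[of "\<sigma> *\<^sub>R \<xi>"] by simp
  qed
  also have "(\<integral>\<xi>. ?F \<xi> \<partial>std_gaussian) = 1 - hellinger \<sigma> \<theta> \<phi> / 2 +
      ((\<integral>\<xi>. h (\<sigma> *\<^sub>R \<xi>) * ?p \<xi> \<partial>std_gaussian) + (\<integral>\<xi>. h (\<sigma> *\<^sub>R \<xi>) * ?q \<xi> \<partial>std_gaussian)) / 2"
    by (simp add: integrable_affinity[OF \<sigma>] integral_affinity[OF \<sigma>] int n)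
  also have "ennreal \<dots> \<le> ennreal (1 - hellinger \<sigma> \<theta> \<phi> / 2 + u * tilt_const TYPE('l))"
    using le[OF n(1)] le[OF n(2)] by (intro ennreal_leI) simp
  finally show ?thesis .
qed

text \<open>Markov's inequality for a nonnegative product, whose mean factors by
  independence.\<close>

lemma chernoff_product:
  fixes r :: "'a \<Rightarrow> real"
  assumes "prob_space P" and [measurable]: "r \<in> borel_measurable P" and r: "\<And>x. 0 \<le> r x"
    and q: "(\<integral>\<^sup>+x. ennreal (r x) \<partial>P) \<le> ennreal q" and "0 \<le> q"
  shows "measure (\<Pi>\<^sub>M i\<in>{..<n}. P) {X \<in> space (\<Pi>\<^sub>M i\<in>{..<n}. P). 1 \<le> (\<Prod>i<n. r (X i))} \<le> q ^ n"
proof -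
  interpret product_prob_space "\<lambda>_::nat. P" "{..<n}" by (intro product_prob_spaceI assms)
  let ?S = "\<Pi>\<^sub>M i\<in>{..<n}. P"
  let ?E = "{X \<in> space ?S. 1 \<le> (\<Prod>i<n. r (X i))}"
  have [measurable]: "(\<lambda>X. r (X i)) \<in> borel_measurable ?S" if "i \<in> {..<n}" for i
    using that by measurable
  have "?E \<in> sets ?S" by measurable
  hence "emeasure ?S ?E = (\<integral>\<^sup>+X. indicator ?E X \<partial>?S)" by simp
  also have "\<dots> \<le> (\<integral>\<^sup>+X. (\<Prod>i<n. ennreal (r (X i))) \<partial>?S)"
    by (intro nn_integral_mono) (auto simp: indicator_def prod_ennreal r prod_nonneg)
  also have "\<dots> = (\<Prod>i<n. \<integral>\<^sup>+x. ennreal (r x) \<partial>P)"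
    by (intro product_nn_integral_prod) auto
  also have "\<dots> \<le> ennreal (q ^ n)"
    using q \<open>0 \<le> q\<close> by (simp add: ennreal_power[symmetric] power_mono)
  finally show ?thesis
    using \<open>0 \<le> q\<close> by (simp add: measure_def enn2real_leI)
qed

text \<open>One point of \<open>B\<close> is kept from each occupied cell of a cubic grid. Taking it
  from \<open>B\<close>, not from the grid, lets it inherit the properties that define
  \<open>B\<close>.\<close>

lemma finite_net:
  fixes B :: "(real ^ 'n::finite) set"
  assumes M: "0 < M" and \<eta>: "0 < \<eta>" and B: "\<And>\<phi> k. \<phi> \<in> B \<Longrightarrow> \<bar>\<phi> $ k\<bar> \<le> M"
  obtains F where "finite F" "F \<subseteq> B" "real (card F) \<le> (2 * M * CARD('n) / \<eta> + 3) ^ CARD('n)"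
    "\<And>\<phi>. \<phi> \<in> B \<Longrightarrow> \<exists>\<psi>\<in>F. norm (\<phi> - \<psi>) \<le> \<eta>"
proof -
  let ?L = "real CARD('n)"
  \<comment> \<open>The cells have side \<open>\<eta> / ?L\<close>, so that \<open>?L\<close>
    coordinate errors add up to at most \<open>\<eta>\<close>.\<close>
  define c where "c \<phi> = (\<lambda>k. \<lfloor>\<phi> $ k * (?L / \<eta>)\<rfloor>)" for \<phi> :: "real ^ 'n"
  define K where "K = \<lceil>M * (?L / \<eta>)\<rceil>"
  have "0 \<le> M * (?L / \<eta>)" using M \<eta> by simp
  hence K: "0 \<le> K" unfolding K_def by linarith
  have "c ` B \<subseteq> PiE UNIV (\<lambda>_. {-K..K})"
  proof
    fix f assume "f \<in> c ` B"
    then obtain \<phi> where \<phi>: "f = c \<phi>" "\<phi> \<in> B" by blast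
    have "- K \<le> c \<phi> k \<and> c \<phi> k \<le> K" for k
    proof -
      have "\<bar>\<phi> $ k * (?L / \<eta>)\<bar> = \<bar>\<phi> $ k\<bar> * (?L / \<eta>)" using \<eta> by (simp add: abs_mult)
      also have "\<dots> \<le> M * (?L / \<eta>)" using B[OF \<phi>(2), of k] \<eta> by (intro mult_right_mono) auto
      finally have le: "\<bar>\<phi> $ k * (?L / \<eta>)\<bar> \<le> M * (?L / \<eta>)" .
      from abs_le_D1[OF le] abs_le_D2[OF le] show ?thesis unfolding c_def K_def by linarith
    qed
    thus "f \<in> PiE UNIV (\<lambda>_. {-K..K})" by (auto simp: \<phi>(1))
  qed
  hence sub: "c ` B \<subseteq> PiE (UNIV :: 'n set) (\<lambda>_. {-K..K})" .
  have finP: "finite (PiE (UNIV :: 'n set) (\<lambda>_. {-K..K}))" by (rule finite_PiE) auto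
  have "K - - K + 1 = 2 * K + 1" by simp
  hence "card {-K..K} = nat (2 * K + 1)" by (simp only: card_atLeastAtMost_int)
  hence "card (PiE (UNIV :: 'n set) (\<lambda>_. {-K..K})) = nat (2 * K + 1) ^ CARD('n)"
    by (simp only: card_PiE[OF finite] prod_constant)
  hence card: "card (c ` B) \<le> nat (2 * K + 1) ^ CARD('n)"
    using card_mono[OF finP sub] by simp
  have fin: "finite (c ` B)" using finite_subset[OF sub finP] .
  let ?F = "inv_into B c ` (c ` B)"
  show ?thesis
  proof
    show "finite ?F" using fin by simp
    show "?F \<subseteq> B" by (auto intro: inv_into_into)
    have "real (card ?F) \<le> real (card (c ` B))" using card_image_le[OF fin] by simp
    also have "\<dots> \<le> real ((nat (2 * K + 1)) ^ CARD('n))" using card by (simp only: of_nat_le_iff)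
    also have "\<dots> = (2 * of_int K + 1) ^ CARD('n)" using K by simp
    also have "\<dots> \<le> (2 * M * ?L / \<eta> + 3) ^ CARD('n)"
    proof (intro power_mono)
      \<comment> \<open>Rounding up costs at most 1 in \<open>K\<close>, which turns
        \<open>2 * K + 1\<close> cells per coordinate into the summand 3.\<close>
      have "of_int K \<le> M * (?L / \<eta>) + 1" unfolding K_def by linarith
      thus "2 * of_int K + 1 \<le> 2 * M * ?L / \<eta> + 3" by simp
    qed (use K in simp)
    finally show "real (card ?F) \<le> (2 * M * ?L / \<eta> + 3) ^ CARD('n)" .
    fix \<phi> assume \<phi>: "\<phi> \<in> B"
    let ?\<psi> = "inv_into B c (c \<phi>)"
    have "c ?\<psi> = c \<phi>" using \<phi> by (intro f_inv_into_f) auto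
    hence eq: "\<lfloor>?\<psi> $ k * (?L / \<eta>)\<rfloor> = \<lfloor>\<phi> $ k * (?L / \<eta>)\<rfloor>" for k
      unfolding c_def by (rule fun_cong)
    have "\<bar>(\<phi> - ?\<psi>) $ k\<bar> \<le> \<eta> / ?L" for k
    proof -
      have "\<bar>\<phi> $ k * (?L / \<eta>) - ?\<psi> $ k * (?L / \<eta>)\<bar> \<le> 1" using eq[of k] by linarith
      hence "\<bar>(\<phi> - ?\<psi>) $ k * (?L / \<eta>)\<bar> \<le> 1"
        by (simp only: vector_minus_component left_diff_distrib)
      hence "\<bar>(\<phi> - ?\<psi>) $ k\<bar> * (?L / \<eta>) \<le> 1"
        using \<eta> by (simp only: abs_mult abs_divide abs_of_nat abs_of_pos)
      thus ?thesis using \<eta> by (simp add: field_simps)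
    qed
    hence "norm (\<phi> - ?\<psi>) \<le> (\<Sum>k\<in>(UNIV :: 'n set). \<eta> / ?L)"
      by (intro order_trans[OF norm_le_l1_cart] sum_mono)
    hence "norm (\<phi> - ?\<psi>) \<le> \<eta>" by simp
    thus "\<exists>\<psi>\<in>?F. norm (\<phi> - \<psi>) \<le> \<eta>" using \<phi> by blast
  qed
qed

text \<open>The exponential is split into two equal halves. As \<open>n\<close> is at least of order
  \<open>t^2\<close>, one half is at most \<open>exp (- t)\<close> and absorbs the power of
  \<open>t\<close>. In the other, \<open>t0 \<le> t\<close> allows the rate \<open>1 / t\<close> to
  be replaced by \<open>t0 / t^2\<close>.\<close>

lemma absorb_polynomial_factor:
  fixes t t0 A a :: real
  assumes t: "t0 \<le> t" and t0: "0 < t0" and A: "0 \<le> A" and a: "0 < a" and n: "2 / a * t\<^sup>2 \<le> real n"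
  shows "(A * t) ^ L * exp (- (a / t)) ^ n \<le> A ^ L * fact L * exp (- (a * t0 / 2 * real n / t\<^sup>2))"
proof -
  have tpos: "0 < t" using t t0 by simp
  let ?h = "a * real n / (2 * t)"
  have "t = a / (2 * t) * (2 / a * t\<^sup>2)" using tpos a by (simp add: power2_eq_square)
  also have "\<dots> \<le> a / (2 * t) * real n" using n tpos a by (intro mult_left_mono) auto
  finally have 1: "t \<le> ?h" by simp
  have "a * t0 / 2 * real n / t\<^sup>2 = (a * real n / (2 * t)) * (t0 / t)"
    by (simp add: power2_eq_square mult_ac)
  also have "\<dots> \<le> ?h * 1" using tpos t a by (intro mult_left_mono) auto
  finally have 2: "a * t0 / 2 * real n / t\<^sup>2 \<le> ?h" by simp
  have "exp (- (a / t)) ^ n = exp (- ?h) * exp (- ?h)"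
    unfolding exp_of_nat_mult[symmetric] exp_add[symmetric] by (simp add: field_simps)
  also have "\<dots> \<le> exp (- t) * exp (- (a * t0 / 2 * real n / t\<^sup>2))"
    using 1 2 by (intro mult_mono) auto
  finally have "(A * t) ^ L * exp (- (a / t)) ^ n
      \<le> (A * t) ^ L * (exp (- t) * exp (- (a * t0 / 2 * real n / t\<^sup>2)))"
    using A tpos by (intro mult_left_mono) auto
  also have "\<dots> = A ^ L * (t ^ L * exp (- t)) * exp (- (a * t0 / 2 * real n / t\<^sup>2))"
    by (simp add: power_mult_distrib)
  also have "\<dots> \<le> A ^ L * fact L * exp (- (a * t0 / 2 * real n / t\<^sup>2))"
  proof (intro mult_right_mono mult_left_mono)
    have "t ^ L * exp (- t) \<le> fact L * exp t * exp (- t)"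
      using power_le_fact_mult_exp[of t L] tpos by (intro mult_right_mono) auto
    thus "t ^ L * exp (- t) \<le> fact L" by (simp add: mult.assoc flip: exp_add)
  qed (use A in auto)
  finally show ?thesis .
qed


section \<open>The restricted maximum likelihood estimator\<close>

lemma sparse_signals_bounded_collision_free:
  "\<theta> \<in> sparse_signals m M \<epsilon> \<sigma> \<Longrightarrow> bounded_collision_free m M \<theta>"
  by (auto simp: sparse_signals_def bounded_collision_free_def)

lemma sparse_signals_norm_le: "\<theta> \<in> sparse_signals m M \<epsilon> \<sigma> \<Longrightarrow> norm \<theta> \<le> \<sigma>"
  by (simp add: sparse_signals_def)

lemma sparse_signals_component_le:
  assumes "\<theta> \<in> sparse_signals m M \<epsilon> \<sigma>" "0 < M"
  shows "\<bar>\<theta> $ k\<bar> \<le> M"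
  using assms by (cases "\<theta> $ k = 0") (auto simp: sparse_signals_def supp_def)

text \<open>The noise level dominates the norm and hence every nonzero entry, so a nonempty
  parameter set keeps \<open>\<sigma>\<close> away from zero.\<close>

lemma sparse_signals_sigma_ge:
  assumes "\<theta> \<in> sparse_signals m M \<epsilon> \<sigma>"
  shows "m \<le> \<sigma>"
proof -
  have "supp \<theta> \<noteq> {}" using assms by (auto simp: sparse_signals_def)
  then obtain k where "k \<in> supp \<theta>" by auto
  hence "m \<le> \<bar>\<theta> $ k\<bar>" using assms by (auto simp: sparse_signals_def)
  also have "\<dots> \<le> norm \<theta>" by (rule component_le_norm_cart)
  also have "\<dots> \<le> \<sigma>" using assms by (rule sparse_signals_norm_le)
  finally show ?thesis .
qed

lemma space_samples: "space (samples \<sigma> n \<theta>) = space (\<Pi>\<^sub>M i\<in>{..<n}. (borel :: ('l::finite signal) measure))"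
  by (simp add: samples_def space_PiM sample_law_def)

text \<open>The inflation in \<open>chernoff_factor\<close> pays for replacing \<open>\<phi>\<close>
  by the nearby \<open>\<psi>\<close>. The resulting event depends on \<open>\<psi>\<close> alone,
  so a union over net points suffices.\<close>

lemma chernoff_factor_prod_ge_1:
  assumes \<sigma>: "0 < \<sigma>" and n: "norm \<phi> \<le> \<sigma>" "norm \<psi> \<le> \<sigma>" and u: "norm (\<phi> - \<psi>) \<le> u * \<sigma>"
    and ge: "log_likelihood \<sigma> n X \<theta> \<le> log_likelihood \<sigma> n X \<phi>"
  shows "1 \<le> (\<Prod>i<n. chernoff_factor \<sigma> u \<theta> \<psi> (X i))"
proof -
  let ?\<xi> = "\<lambda>i. (1 / \<sigma>) *\<^sub>R X i"
  have "(\<Sum>i<n. ln (likelihood_ratio \<sigma> \<theta> (?\<xi> i))) \<le> (\<Sum>i<n. ln (likelihood_ratio \<sigma> \<phi> (?\<xi> i)))"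
    using ge unfolding log_likelihood_eq[OF \<sigma>] by simp
  also have "\<dots> \<le> (\<Sum>i<n. ln (likelihood_ratio \<sigma> \<psi> (?\<xi> i)) + u * (norm (?\<xi> i) + 1))"
    by (intro sum_mono likelihood_ratio_lipschitz[OF \<sigma> n u])
  finally have "0 \<le> (\<Sum>i<n. (ln (likelihood_ratio \<sigma> \<psi> (?\<xi> i)) - ln (likelihood_ratio \<sigma> \<theta> (?\<xi> i))
           + u * (norm (?\<xi> i) + 1)) / 2)"
    unfolding sum_divide_distrib[symmetric] by (simp add: sum.distrib sum_subtractf)
  thus ?thesis unfolding chernoff_factor_def by (subst exp_sum[symmetric]) auto
qed

text \<open>A union bound over a net of the signals far from \<open>\<theta>\<close>. The mesh
  parameter \<open>u\<close> balances the size of the net against the tilting loss, which half the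
  Hellinger distance has to exceed by the rate \<open>a\<close>.\<close>

lemma restricted_MLE_deviation:
  fixes \<theta> :: "'l::finite signal"
  assumes m: "0 < m" and M: "0 < M" and \<theta>: "\<theta> \<in> sparse_signals m M \<epsilon> \<sigma>"
    and est: "restricted_MLE m M \<epsilon> \<sigma> n est"
    and u: "0 < u" "u \<le> 1"
    and hell: "\<And>\<phi>. \<phi> \<in> sparse_signals m M \<epsilon> \<sigma> \<Longrightarrow> \<delta> \<le> orbit_dist \<phi> \<theta> \<Longrightarrow>
      a + u * tilt_const TYPE('l) \<le> hellinger \<sigma> \<theta> \<phi> / 2"
  shows "measure (samples \<sigma> n \<theta>) {X \<in> space (samples \<sigma> n \<theta>). orbit_dist (est X) \<theta> \<ge> \<delta>}
    \<le> (2 * M * CARD('l) / (u * \<sigma>) + 3) ^ CARD('l) * exp (- a) ^ n"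
proof -
  have \<sigma>: "0 < \<sigma>" using sparse_signals_sigma_ge[OF \<theta>] m by simp
  let ?S = "samples \<sigma> n \<theta>"
  define B where "B = {\<phi> \<in> sparse_signals m M \<epsilon> \<sigma>. \<delta> \<le> orbit_dist \<phi> \<theta>}"
  have BM: "\<bar>\<phi> $ k\<bar> \<le> M" if "\<phi> \<in> B" for \<phi> k
    using that sparse_signals_component_le[OF _ M] by (auto simp: B_def)
  have us: "0 < u * \<sigma>" using u \<sigma> by simp
  obtain F where F: "finite F" "F \<subseteq> B" "real (card F) \<le> (2 * M * CARD('l mod_ring) / (u * \<sigma>) + 3) ^ CARD('l mod_ring)"
    and net: "\<And>\<phi>. \<phi> \<in> B \<Longrightarrow> \<exists>\<psi>\<in>F. norm (\<phi> - \<psi>) \<le> u * \<sigma>"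
    using finite_net[OF M us, of B] BM by metis
  interpret S: prob_space ?S unfolding samples_def by (intro prob_space_PiM prob_space_sample_law)
  let ?E = "\<lambda>\<psi>. {X \<in> space ?S. 1 \<le> (\<Prod>i<n. chernoff_factor \<sigma> u \<theta> \<psi> (X i))}"
  have meas: "?E \<psi> \<in> sets ?S" for \<psi>
  proof -
    have c: "chernoff_factor \<sigma> u \<theta> \<psi> \<in> borel_measurable (sample_law \<sigma> \<theta>)"
      by (simp add: measurable_cong_sets[OF sets_sample_law refl])
    have "(\<lambda>X. chernoff_factor \<sigma> u \<theta> \<psi> (X i)) \<in> borel_measurable ?S" if "i \<in> {..<n}" for i
      unfolding samples_def by (rule measurable_compose[OF measurable_component_singleton[OF that] c])
    thus ?thesis by (intro borel_measurable_le borel_measurable_const borel_measurable_prod)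
  qed
  have bound: "measure ?S (?E \<psi>) \<le> exp (- a) ^ n" if "\<psi> \<in> F" for \<psi>
  proof -
    have \<psi>: "\<psi> \<in> sparse_signals m M \<epsilon> \<sigma>" "\<delta> \<le> orbit_dist \<psi> \<theta>" using that F by (auto simp: B_def)
    have "(\<integral>\<^sup>+x. ennreal (chernoff_factor \<sigma> u \<theta> \<psi> x) \<partial>sample_law \<sigma> \<theta>)
       \<le> ennreal (1 - hellinger \<sigma> \<theta> \<psi> / 2 + u * tilt_const TYPE('l))"
      using u \<sigma> sparse_signals_norm_le[OF \<theta>] sparse_signals_norm_le[OF \<psi>(1)]
      by (intro nn_integral_chernoff_factor) auto
    \<comment> \<open>The margin in \<open>hell\<close> bounds the mean by \<open>1 - a\<close>,
      which is at most \<open>exp (- a)\<close>.\<close>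
    also have "\<dots> \<le> ennreal (exp (- a))"
      using hell[OF \<psi>] exp_ge_add_one_self[of "- a"] by (intro ennreal_leI) simp
    finally have "(\<integral>\<^sup>+x. ennreal (chernoff_factor \<sigma> u \<theta> \<psi> x) \<partial>sample_law \<sigma> \<theta>) \<le> ennreal (exp (- a))" .
    thus ?thesis unfolding samples_def
      by (intro chernoff_product prob_space_sample_law)
         (auto simp: measurable_cong_sets[OF sets_sample_law refl] chernoff_factor_def[of \<sigma> u \<theta> \<psi> x for x])
  qed
  have "{X \<in> space ?S. orbit_dist (est X) \<theta> \<ge> \<delta>} \<subseteq> (\<Union>\<psi>\<in>F. ?E \<psi>)"
  proof
    fix X assume "X \<in> {X \<in> space ?S. orbit_dist (est X) \<theta> \<ge> \<delta>}"
    hence X: "X \<in> space ?S" "orbit_dist (est X) \<theta> \<ge> \<delta>" by auto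
    have "is_arg_max (log_likelihood \<sigma> n X) (\<lambda>\<phi>. \<phi> \<in> sparse_signals m M \<epsilon> \<sigma>) (est X)"
      using est X(1) unfolding restricted_MLE_def space_samples by blast
    \<comment> \<open>The true signal is itself a competitor of the maximiser.\<close>
    hence T: "est X \<in> sparse_signals m M \<epsilon> \<sigma>" and ge: "log_likelihood \<sigma> n X \<theta> \<le> log_likelihood \<sigma> n X (est X)"
      using \<theta> unfolding is_arg_max_def by (auto simp: not_less)
    hence "est X \<in> B" using X by (simp add: B_def)
    from net[OF this] obtain \<psi> where \<psi>: "\<psi> \<in> F" "norm (est X - \<psi>) \<le> u * \<sigma>" by auto
    moreover have "\<psi> \<in> sparse_signals m M \<epsilon> \<sigma>" using \<psi>(1) F(2) by (auto simp: B_def)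
    hence "norm \<psi> \<le> \<sigma>" by (rule sparse_signals_norm_le)
    ultimately have "1 \<le> (\<Prod>i<n. chernoff_factor \<sigma> u \<theta> \<psi> (X i))"
      using chernoff_factor_prod_ge_1[OF \<sigma> sparse_signals_norm_le[OF T] _ _ ge] by blast
    thus "X \<in> (\<Union>\<psi>\<in>F. ?E \<psi>)" using X(1) \<psi>(1) by blast
  qed
  hence "measure ?S {X \<in> space ?S. orbit_dist (est X) \<theta> \<ge> \<delta>} \<le> measure ?S (\<Union>\<psi>\<in>F. ?E \<psi>)"
    using meas F(1) by (intro S.finite_measure_mono) auto
  also have "\<dots> \<le> (\<Sum>\<psi>\<in>F. measure ?S (?E \<psi>))"
    using meas F(1) by (intro S.finite_measure_subadditive_finite) auto
  also have "\<dots> \<le> (\<Sum>\<psi>\<in>F. exp (- a) ^ n)" by (intro sum_mono bound)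
  also have "\<dots> = real (card F) * exp (- a) ^ n" by simp
  also have "\<dots> \<le> (2 * M * CARD('l) / (u * \<sigma>) + 3) ^ CARD('l) * exp (- a) ^ n"
    using F(3) by (intro mult_right_mono) auto
  finally show ?thesis .
qed

section \<open>Choice of the constants and conclusion\<close>

theorem theorem1p4p2:
  fixes m M \<epsilon> :: real
  assumes "0 < m" and "0 < M" and "0 < \<epsilon>"
  shows "\<forall>s::nat. \<exists>C > 0. \<exists>C' > 0.
    \<forall>(\<delta>::real) (\<sigma>::real) (n::nat) (\<theta> :: 'l::finite signal) est.
      0 < \<delta> \<longrightarrow> \<delta> < 2 * sqrt (real CARD('l)) * M \<longrightarrow> 0 < \<sigma> \<longrightarrow>
      real n \<ge> C * \<sigma> ^ 12 / \<delta> ^ 4 \<longrightarrow>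
      \<theta> \<in> sparse_signals m M \<epsilon> \<sigma> \<longrightarrow> card (supp \<theta>) = s \<longrightarrow>
      restricted_MLE m M \<epsilon> \<sigma> n est \<longrightarrow>
      measure (samples \<sigma> n \<theta>)
        {X \<in> space (samples \<sigma> n \<theta>). orbit_dist (est X) \<theta> \<ge> \<delta>}
      \<le> C * \<sigma> ^ (5 * s) / \<delta> ^ (2 * s) * exp (- (C' * real n * \<delta> ^ 4 / \<sigma> ^ 12))"
proof
  fix s :: nat
  obtain c where c: "c > 0" and hell:
    "\<And>\<sigma> \<theta> \<phi>. m \<le> \<sigma> \<Longrightarrow> norm \<theta> \<le> \<sigma> \<Longrightarrow> norm \<phi> \<le> \<sigma> \<Longrightarrow>
       bounded_collision_free m M \<theta> \<Longrightarrow> bounded_collision_free m M (\<phi> :: 'l signal) \<Longrightarrow>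
       c * (orbit_dist \<phi> \<theta>)\<^sup>2 / \<sigma> ^ 6 \<le> hellinger \<sigma> \<theta> \<phi>"
    using orbit_dist_le_hellinger[OF \<open>0 < m\<close> \<open>0 < M\<close>] by metis
  let ?L = "real CARD('l)" and ?k = "tilt_const TYPE('l)"
  \<comment> \<open>All constants are fixed before \<open>\<delta>\<close> and
    \<open>\<sigma>\<close>. As \<open>\<delta>\<close> is below \<open>D\<close> and
    \<open>\<sigma>\<close> is at least \<open>m\<close>, the numbers \<open>t0\<close> and
    \<open>p\<close> bound \<open>\<sigma> ^ 6 / \<delta>^2\<close> and
    \<open>\<sigma> ^ 5 / \<delta>^2\<close> from below.\<close>
  define D where "D = 2 * sqrt ?L * M"
  define t0 where "t0 = m ^ 6 / D\<^sup>2"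
  \<comment> \<open>The mesh will be \<open>\<kappa> / t\<close>. The first entry of the minimum
    keeps the tilting loss at most \<open>c / (4 * t)\<close>, the second keeps the mesh at most
    1.\<close>
  define \<kappa> where "\<kappa> = min (c / (4 * ?k)) t0"
  \<comment> \<open>Half the Hellinger distance is at least \<open>c / (2 * t)\<close>, that is
    \<open>2 * a / t\<close>. One share \<open>a / t\<close> pays for the tilting, the other is the
    exponential rate.\<close>
  define a where "a = c / 4"
  \<comment> \<open>The two summands of \<open>A\<close> match the two summands in the base of the
    net size, which is then at most \<open>A * t\<close>.\<close>
  define A where "A = 2 * M * ?L / (\<kappa> * m) + 3 / t0"
  define p where "p = m ^ 5 / D\<^sup>2"
  \<comment> \<open>The first summand makes \<open>C * p ^ s\<close> dominate the factor left over
    from the net. The second turns the assumption on the sample size into that of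
    \<open>absorb_polynomial_factor\<close>.\<close>
  define C where "C = A ^ CARD('l) * fact CARD('l) / p ^ s + 2 / a"
  have k: "0 < ?k"
    unfolding tilt_const_def using integral_exp_norm_ge_1[where 'a = 'l] by (intro mult_pos_pos) auto
  have D: "0 < D" unfolding D_def using \<open>0 < M\<close> by simp
  have t0: "0 < t0" unfolding t0_def using D \<open>0 < m\<close> by simp
  have \<kappa>: "0 < \<kappa>" "\<kappa> \<le> t0" "\<kappa> * ?k \<le> c / 4"
    unfolding \<kappa>_def using c k t0 by (auto simp: min_def field_simps)
  have a: "0 < a" unfolding a_def using c by simp
  have A: "0 < A" unfolding A_def using \<kappa> t0 \<open>0 < m\<close> \<open>0 < M\<close> by (intro add_pos_pos) auto
  have p: "0 < p" unfolding p_def using D \<open>0 < m\<close> by simp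
  have C: "0 < C" "2 / a \<le> C" "A ^ CARD('l) * fact CARD('l) \<le> C * p ^ s"
    unfolding C_def using A p a by (auto simp: add_pos_pos field_simps)
  show "\<exists>C > 0. \<exists>C' > 0.
    \<forall>(\<delta>::real) (\<sigma>::real) (n::nat) (\<theta> :: 'l signal) est.
      0 < \<delta> \<longrightarrow> \<delta> < 2 * sqrt (real CARD('l)) * M \<longrightarrow> 0 < \<sigma> \<longrightarrow>
      real n \<ge> C * \<sigma> ^ 12 / \<delta> ^ 4 \<longrightarrow>
      \<theta> \<in> sparse_signals m M \<epsilon> \<sigma> \<longrightarrow> card (supp \<theta>) = s \<longrightarrow>
      restricted_MLE m M \<epsilon> \<sigma> n est \<longrightarrow>
      measure (samples \<sigma> n \<theta>)
        {X \<in> space (samples \<sigma> n \<theta>). orbit_dist (est X) \<theta> \<ge> \<delta>}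
      \<le> C * \<sigma> ^ (5 * s) / \<delta> ^ (2 * s) * exp (- (C' * real n * \<delta> ^ 4 / \<sigma> ^ 12))"
  proof (rule exI[of _ C], rule conjI[OF C(1)], rule exI[of _ "a * t0 / 2"], intro conjI allI impI)
    show "0 < a * t0 / 2" using a t0 by simp
    fix \<delta> \<sigma> :: real and n and \<theta> :: "'l signal"
      and est :: "(nat \<Rightarrow> 'l signal) \<Rightarrow> 'l signal"
    assume \<delta>: "0 < \<delta>" "\<delta> < 2 * sqrt (real CARD('l)) * M" and \<sigma>: "0 < \<sigma>"
      and n: "C * \<sigma> ^ 12 / \<delta> ^ 4 \<le> real n"
      and \<theta>: "\<theta> \<in> sparse_signals m M \<epsilon> \<sigma>" and est: "restricted_MLE m M \<epsilon> \<sigma> n est"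
    have m\<sigma>: "m \<le> \<sigma>" by (rule sparse_signals_sigma_ge[OF \<theta>])
    have \<delta>D: "\<delta>\<^sup>2 \<le> D\<^sup>2" using \<delta> unfolding D_def by (intro power_mono) auto
    define t where "t = \<sigma> ^ 6 / \<delta>\<^sup>2"
    have t2: "t\<^sup>2 = \<sigma> ^ 12 / \<delta> ^ 4" unfolding t_def by (simp add: power_divide flip: power_mult)
    have tt0: "t0 \<le> t" unfolding t_def t0_def
      using \<open>0 < m\<close> \<sigma> \<delta> by (intro frac_le[OF _ power_mono[OF m\<sigma>] _ \<delta>D]) auto
    have t: "0 < t" using tt0 t0 by simp
    define u where "u = \<kappa> / t"
    have u: "0 < u" "u \<le> 1" unfolding u_def using \<kappa> t tt0 by auto
    have uk: "u * ?k \<le> a / t"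
    proof -
      have "\<kappa> * ?k / t \<le> c / 4 / t" using \<kappa>(3) t by (intro divide_right_mono) auto
      thus ?thesis by (simp add: u_def a_def)
    qed
    have h: "a / t + u * ?k \<le> hellinger \<sigma> \<theta> \<phi> / 2"
      if \<phi>: "\<phi> \<in> sparse_signals m M \<epsilon> \<sigma>" "\<delta> \<le> orbit_dist \<phi> \<theta>" for \<phi>
    proof -
      have "a / t + u * ?k \<le> 2 * a / t" using uk by simp
      also have "\<dots> = c * \<delta>\<^sup>2 / \<sigma> ^ 6 / 2" unfolding a_def t_def by simp
      also have "\<dots> \<le> c * (orbit_dist \<phi> \<theta>)\<^sup>2 / \<sigma> ^ 6 / 2"
        using c \<delta> \<phi>(2) \<sigma> by (intro divide_right_mono mult_left_mono power_mono) auto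
      also have "\<dots> \<le> hellinger \<sigma> \<theta> \<phi> / 2"
        by (intro divide_right_mono hell m\<sigma> sparse_signals_norm_le[OF \<theta>] sparse_signals_norm_le[OF \<phi>(1)]
            sparse_signals_bounded_collision_free[OF \<theta>] sparse_signals_bounded_collision_free[OF \<phi>(1)]) simp
      finally show ?thesis .
    qed
    have net: "2 * M * ?L / (u * \<sigma>) + 3 \<le> A * t"
    proof -
      have "2 * M * ?L / (u * \<sigma>) \<le> 2 * M * ?L / (u * m)"
        using m\<sigma> \<open>0 < m\<close> \<open>0 < M\<close> u by (intro divide_left_mono mult_left_mono) auto
      also have "\<dots> = 2 * M * ?L / (\<kappa> * m) * t" unfolding u_def by simp
      finally have 1: "2 * M * ?L / (u * \<sigma>) \<le> 2 * M * ?L / (\<kappa> * m) * t" .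
      have "3 \<le> 3 / t0 * t" using tt0 t0 by (simp add: field_simps)
      thus ?thesis using 1 by (simp add: A_def distrib_right)
    qed
    have "2 / a * t\<^sup>2 \<le> C * t\<^sup>2" using C(2) by (intro mult_right_mono) auto
    hence n': "2 / a * t\<^sup>2 \<le> real n" using n by (simp add: t2)
    have "measure (samples \<sigma> n \<theta>) {X \<in> space (samples \<sigma> n \<theta>). orbit_dist (est X) \<theta> \<ge> \<delta>}
      \<le> (2 * M * ?L / (u * \<sigma>) + 3) ^ CARD('l) * exp (- (a / t)) ^ n"
      by (rule restricted_MLE_deviation[OF \<open>0 < m\<close> \<open>0 < M\<close> \<theta> est u h])
    also have "\<dots> \<le> (A * t) ^ CARD('l) * exp (- (a / t)) ^ n"
      using net u \<sigma> \<open>0 < M\<close> by (intro mult_right_mono power_mono) auto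
    also have "\<dots> \<le> A ^ CARD('l) * fact CARD('l) * exp (- (a * t0 / 2 * real n / t\<^sup>2))"
      using A by (intro absorb_polynomial_factor[OF tt0 t0 _ a n']) auto
    also have "\<dots> \<le> C * \<sigma> ^ (5 * s) / \<delta> ^ (2 * s) * exp (- (a * t0 / 2 * real n / t\<^sup>2))"
    proof (rule mult_right_mono)
      \<comment> \<open>The prefactor of the claim is at least \<open>C * p ^ s\<close>, so it
        already dominates the constant obtained.\<close>
      have "p \<le> \<sigma> ^ 5 / \<delta>\<^sup>2" unfolding p_def
        using \<open>0 < m\<close> \<sigma> \<delta> by (intro frac_le[OF _ power_mono[OF m\<sigma>] _ \<delta>D]) auto
      hence "C * p ^ s \<le> C * (\<sigma> ^ 5 / \<delta>\<^sup>2) ^ s" using p C(1) by (intro mult_left_mono power_mono) auto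
      also have "\<dots> = C * \<sigma> ^ (5 * s) / \<delta> ^ (2 * s)" by (simp add: power_divide flip: power_mult)
      finally show "A ^ CARD('l) * fact CARD('l) \<le> C * \<sigma> ^ (5 * s) / \<delta> ^ (2 * s)" using C(3) by simp
    qed simp
    also have "a * t0 / 2 * real n / t\<^sup>2 = a * t0 / 2 * real n * \<delta> ^ 4 / \<sigma> ^ 12"
      unfolding t2 by simp
    finally show "measure (samples \<sigma> n \<theta>) {X \<in> space (samples \<sigma> n \<theta>). orbit_dist (est X) \<theta> \<ge> \<delta>}
      \<le> C * \<sigma> ^ (5 * s) / \<delta> ^ (2 * s) * exp (- (a * t0 / 2 * real n * \<delta> ^ 4 / \<sigma> ^ 12))" .
  qed
qed

end
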